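(* Let $\hat\theta^{\mathcal T}\in\arg\min_{\theta\in\Theta}\min_{M\in\mathcal M}\widehat{\mathcal R}^{\mathcal T}_{\theta,M}$ be obtained using only the target data set $\mathcal D^{\mathcal T}$ of $N^{\mathcal T}$ i.i.d. samples from $p^{\mathcal T}(c,x)$. For every $\delta\in(0,1)$, with probability at least $1-\delta$ over the draw of $\mathcal D^{\mathcal T}$, $$\mathcal R^{\mathcal T}_{\hat\theta^{\mathcal T},\widehat M^{\mathcal T}_{\hat\theta^{\mathcal T}}}-\mathcal R^{\mathcal T}_{\hat\theta^{\mathcal T}}\le\frac{2(\mathfrak R^{\mathcal T}_{\Theta,\mathcal M}+\mathfrak R^{\mathcal T}_{\mathcal M})}{\sqrt{N^{\mathcal T}}}+\sqrt{\frac{2}{N^{\mathcal T}}\log\frac2\delta},$$ where moreover $\mathfrak R^{\mathcal T}_{\mathcal M}\le\tfrac12\sqrt{\sup_{\theta\in\Theta}2^{I^{\mathcal T}_2(X;R_\theta)}}$.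
   Context: $\mathcal X$ finite, labels $c\in\{0,1\}$, $\Theta$ arbitrary, $\rho_\theta(x)$ density matrices on $\mathbb C^n$, $\mathcal M$ the binary POVMs $M=(M_0,M_1)$, $M_c\succeq0$, $M_0+M_1=I$; loss $\ell_{\theta,M}(c,x)=1-\mathrm{Tr}(M_c\rho_\theta(x))$. For task $\mathcal A\in\{\mathcal S,\mathcal T\}$ with distribution $p^{\mathcal A}(c,x)$ and data set $\mathcal D^{\mathcal A}$ of $N^{\mathcal A}$ i.i.d. samples: expected risk $\mathcal R^{\mathcal A}_{\theta,M}=\mathbb E_{p^{\mathcal A}}[\ell_{\theta,M}]$, $\mathcal R^{\mathcal A}_\theta=\min_M\mathcal R^{\mathcal A}_{\theta,M}$, empirical risk $\widehat{\mathcal R}^{\mathcal A}_{\theta,M}=\frac1{N^{\mathcal A}}\sum_{(c,x)\in\mathcal D^{\mathcal A}}\ell_{\theta,M}(c,x)$, and $\widehat M^{\mathcal A}_\theta\in\arg\min_{M\in\mathcal M}\widehat{\mathcal R}^{\mathcal A}_{\theta,M}$ (minimizers assumed to exist). Rademacher complexities (with $(c_j,x_j)$ i.i.d. from $p^{\mathcal A}$ and independent uniform signs $\sigma_j\in\{\pm1\}$): $\mathfrak R^{\mathcal A}_{\mathcal M}=\sup_{\theta}\mathbb E[\sup_{M}\sum_{j=1}^{N^{\mathcal A}}\sigma_j\ell_{\theta,M}(c_j,x_j)/\sqrt{N^{\mathcal A}}]$ and $\mathfrak R^{\mathcal A}_{\Theta,\mathcal M}=\mathbb E[\sup_{\theta,M}\sum_{j=1}^{N^{\mathcal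 A}}\sigma_j\ell_{\theta,M}(c_j,x_j)/\sqrt{N^{\mathcal A}}]$. The 2-Rényi mutual information is $I^{\mathcal A}_2(X;R_\theta)=2\log_2\mathrm{Tr}\bigl(\sqrt{\sum_x p^{\mathcal A}(x)\rho_\theta(x)^2}\bigr)$, where $p^{\mathcal A}(x)$ is the input marginal. *)

theory Defs
  imports "HOL-Analysis.Analysis" "HOL-Probability.Probability"
begin

text \<open>Complex n x n matrices are represented as complex^'n^'n (dimension n = CARD('n)).
  Labels c in {0,1} are represented by bool (False = 0, True = 1).\<close>

definition cadj :: "complex^'n^'n \<Rightarrow> complex^'n^'n" where
  "cadj A = (\<chi> i j. cnj (A $ j $ i))"

definition hermitian :: "complex^'n^'n \<Rightarrow> bool" where
  "hermitian A \<longleftrightarrow> cadj A = A"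

definition psd :: "complex^'n^'n \<Rightarrow> bool" where
  "psd A \<longleftrightarrow> hermitian A \<and> (\<forall>v :: complex^'n. 0 \<le> Re (\<Sum>i\<in>UNIV. cnj (v $ i) * (A *v v) $ i))"

definition ctrace :: "complex^'n^'n \<Rightarrow> complex" where
  "ctrace A = (\<Sum>i\<in>UNIV. A $ i $ i)"

definition density_matrix :: "complex^'n^'n \<Rightarrow> bool" where
  "density_matrix A \<longleftrightarrow> psd A \<and> ctrace A = 1"

definition povm :: "(bool \<Rightarrow> complex^'n^'n) \<Rightarrow> bool" where
  "povm M \<longleftrightarrow> psd (M False) \<and> psd (M True) \<and> M False + M True = mat 1"

definition msqrt :: "complex^'n^'n \<Rightarrow> complex^'n^'n" where
  "msqrt A = (THE B. psd B \<and> B ** B = A)"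

text \<open>Loss: 1 - Tr(M_c rho_theta(x)) (a real number for PSD M_c and density rho).\<close>
definition loss :: "('t \<Rightarrow> 'x \<Rightarrow> complex^'n^'n) \<Rightarrow> 't \<Rightarrow> (bool \<Rightarrow> complex^'n^'n) \<Rightarrow> bool \<times> 'x \<Rightarrow> real" where
  "loss rho \<theta> M cx = 1 - Re (ctrace (M (fst cx) ** rho \<theta> (snd cx)))"

definition exp_risk :: "(bool \<times> 'x) pmf \<Rightarrow> ('t \<Rightarrow> 'x \<Rightarrow> complex^'n^'n) \<Rightarrow> 't \<Rightarrow> (bool \<Rightarrow> complex^'n^'n) \<Rightarrow> real" where
  "exp_risk p rho \<theta> M = measure_pmf.expectation p (loss rho \<theta> M)"

text \<open>R_theta = min over POVMs of the expected risk (the minimum is attained; written as infimum).\<close>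
definition opt_risk :: "(bool \<times> 'x) pmf \<Rightarrow> ('t \<Rightarrow> 'x \<Rightarrow> complex^'n^'n) \<Rightarrow> 't \<Rightarrow> real" where
  "opt_risk p rho \<theta> = (INF M\<in>{M. povm M}. exp_risk p rho \<theta> M)"

text \<open>A data set of N samples is a function D with D j the j-th sample, j < N.\<close>
definition emp_risk :: "nat \<Rightarrow> ('t \<Rightarrow> 'x \<Rightarrow> complex^'n^'n) \<Rightarrow> 't \<Rightarrow> (bool \<Rightarrow> complex^'n^'n) \<Rightarrow> (nat \<Rightarrow> bool \<times> 'x) \<Rightarrow> real" where
  "emp_risk N rho \<theta> M D = (\<Sum>j<N. loss rho \<theta> M (D j)) / real N"

definition sample_pmf :: "nat \<Rightarrow> 'a pmf \<Rightarrow> (nat \<Rightarrow> 'a) pmf" where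
  "sample_pmf N p = Pi_pmf {..<N} undefined (\<lambda>_. p)"

definition rademacher :: "real pmf" where
  "rademacher = pmf_of_set {-1, 1}"

definition rad_M :: "nat \<Rightarrow> (bool \<times> 'x) pmf \<Rightarrow> ('t \<Rightarrow> 'x \<Rightarrow> complex^'n^'n) \<Rightarrow> real" where
  "rad_M N p rho = (SUP \<theta>. measure_pmf.expectation (sample_pmf N (pair_pmf p rademacher))
      (\<lambda>S. SUP M\<in>{M. povm M}. (\<Sum>j<N. snd (S j) * loss rho \<theta> M (fst (S j))) / sqrt (real N)))"

definition rad_TM :: "nat \<Rightarrow> (bool \<times> 'x) pmf \<Rightarrow> ('t \<Rightarrow> 'x \<Rightarrow> complex^'n^'n) \<Rightarrow> real" where
  "rad_TM N p rho = measure_pmf.expectation (sample_pmf N (pair_pmf p rademacher))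
      (\<lambda>S. SUP \<theta>M\<in>UNIV \<times> {M. povm M}.
         (\<Sum>j<N. snd (S j) * loss rho (fst \<theta>M) (snd \<theta>M) (fst (S j))) / sqrt (real N))"

definition renyi2_MI :: "(bool \<times> 'x::finite) pmf \<Rightarrow> ('t \<Rightarrow> 'x \<Rightarrow> complex^'n^'n) \<Rightarrow> 't \<Rightarrow> real" where
  "renyi2_MI p rho \<theta> = 2 * log 2 (Re (ctrace (msqrt
      (\<Sum>x\<in>UNIV. pmf (map_pmf snd p) x *\<^sub>R (rho \<theta> x ** rho \<theta> x)))))"

end

theory Submission
  imports Defs
begin

text \<open>
  Since \<open>thetahat\<close> minimises the empirical risk over all parameters, the excess risk is at most
  \<open>G D + H D - E H\<close>, where \<open>G\<close> is the supremum over \<open>(\<theta>, M)\<close> of expected minus empirical risk and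
  \<open>H\<close> is the minimal empirical risk: \<open>E H\<close> is below every expected risk, hence below the optimal risk.
  Changing one sample changes \<open>G + H\<close> by at most \<open>2 / N\<close>, so a single application of McDiarmid's
  inequality gives the deviation term, and symmetrization bounds \<open>E G\<close> by \<open>rad_TM\<close>;
  the term \<open>rad_M\<close> only enters through its nonnegativity.

  For the Renyi bound, the loss is \<open>1/2 \<mp> Tr (K \<rho>) / 2\<close> with the contraction \<open>K = M\<^sub>1 - M\<^sub>0\<close>.
  Let \<open>Q\<close> be the randomly signed sum of the sampled states divided by \<open>\<surd>N\<close>, and \<open>e\<close> run through an
  orthonormal eigenbasis of \<open>A = E Q\<^sup>2 = \<Sum>\<^sub>x p(x) \<rho>(x)\<^sup>2\<close>. Then \<open>E sup\<^sub>K Tr (K Q) \<le> \<Sum>\<^sub>e E |Q e|\<close>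
  and \<open>E |Q e| \<le> \<surd>(E |Q e|\<^sup>2) = \<surd>\<langle>e, A e\<rangle>\<close>, which sums to the trace of the square root of \<open>A\<close>.

  Complex matrices are treated as real-linear operators on the Euclidean space \<open>complex^'n\<close>, whose
  inner product is the real part of the Hermitian one; the real trace of such an operator is
  twice the real part of the complex trace.
\<close>

section \<open>Self-adjoint operators and square roots of matrices\<close>

text \<open>Completeness is encoded as the expansion identity instead of a spanning condition,
  because the expansion is what the trace and norm computations rewrite with.\<close>

definition onb :: "'a::euclidean_space set \<Rightarrow> bool" where
  "onb E \<longleftrightarrow> finite E \<and> (\<forall>e\<in>E. norm e = 1) \<and> pairwise orthogonal E \<and> (\<forall>v. (\<Sum>e\<in>E. (v \<bullet> e) *\<^sub>R e) = v)"

definition selfadj :: "('a::euclidean_space \<Rightarrow> 'a) \<Rightarrow> bool" where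
  "selfadj f \<longleftrightarrow> linear f \<and> (\<forall>x y. f x \<bullet> y = x \<bullet> f y)"

definition rtrace :: "('a::euclidean_space \<Rightarrow> 'a) \<Rightarrow> real" where
  "rtrace f = (\<Sum>b\<in>Basis. b \<bullet> f b)"

text \<open>Rayleigh quotient argument: with \<open>c\<close> the maximum of the quadratic form on
  the unit sphere of \<open>W\<close>, attained at \<open>v\<close>, the operator
  \<open>g = c - f\<close> has a nonnegative form on \<open>W\<close> that vanishes at
  \<open>v\<close>. Perturbing \<open>v\<close> along \<open>u = g v\<close> then forces
  \<open>u = 0\<close>.\<close>

lemma selfadj_eigenvector_exists:
  fixes f :: "'a::euclidean_space \<Rightarrow> 'a"
  assumes f: "selfadj f" and W: "subspace W" "W \<noteq> {0}" and inv: "\<And>w. w \<in> W \<Longrightarrow> f w \<in> W"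
  obtains v c where "v \<in> W" "norm v = 1" "f v = c *\<^sub>R v"
proof -
  have lin: "linear f" and sa: "\<And>x y. f x \<bullet> y = x \<bullet> f y"
    using f by (auto simp: selfadj_def)
  let ?K = "W \<inter> sphere 0 1"
  have "compact ?K"
    using W by (intro closed_Int_compact closed_subspace) auto
  moreover have "?K \<noteq> {}"
  proof -
    obtain w where "w \<in> W" "w \<noteq> 0" using W subspace_0 by blast
    then have "w /\<^sub>R norm w \<in> ?K" using W by (auto simp: subspace_scale)
    then show ?thesis by blast
  qed
  moreover have "continuous_on ?K (\<lambda>w. w \<bullet> f w)"
    using lin by (intro continuous_intros linear_continuous_on) (simp add: linear_conv_bounded_linear)
  ultimately obtain v where v: "v \<in> ?K" and max: "\<And>w. w \<in> ?K \<Longrightarrow> w \<bullet> f w \<le> v \<bullet> f v"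
    using continuous_attains_sup[of ?K "\<lambda>w. w \<bullet> f w"] by blast
  define c where "c = v \<bullet> f v"
  have vv: "v \<bullet> v = 1" using v by (simp add: dot_square_norm)
  define g where "g w = c *\<^sub>R w - f w" for w
  have g_nonneg: "w \<bullet> g w \<ge> 0" if "w \<in> W" for w
  proof (cases "w = 0")
    case False
    then have "w /\<^sub>R norm w \<in> ?K" using that W by (auto simp: subspace_scale)
    from max[OF this] have "(w \<bullet> f w) / (norm w)\<^sup>2 \<le> c"
      by (simp add: c_def linear_scale[OF lin] power2_eq_square field_simps)
    then show ?thesis
      using False by (simp add: g_def inner_diff_right divide_le_eq dot_square_norm)
  qed (simp)
  define u where "u = g v"
  have u: "u \<in> W" using v W inv by (simp add: u_def g_def subspace_diff subspace_scale)
  have "g x \<bullet> y = x \<bullet> g y" for x y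
    by (simp add: g_def inner_diff sa)
  from this[of v u] have gu: "v \<bullet> g u = u \<bullet> u"
    by (simp add: u_def)
  \<comment> \<open>The form of \<open>g\<close> is zero at \<open>v\<close> and nonnegative at
    \<open>v - t *\<^sub>R u\<close>, so the negative term linear in \<open>t\<close> must be
    compensated by the quadratic one.\<close>
  have "2 * (u \<bullet> u) \<le> t * (u \<bullet> g u)" if "t > 0" for t
  proof -
    have "0 \<le> (v - t *\<^sub>R u) \<bullet> g (v - t *\<^sub>R u)"
      using u v W by (intro g_nonneg) (simp add: subspace_diff subspace_scale)
    also have "g (v - t *\<^sub>R u) = g v - t *\<^sub>R g u"
      by (simp add: g_def linear_diff[OF lin] linear_scale[OF lin] algebra_simps)
    also have "(v - t *\<^sub>R u) \<bullet> (g v - t *\<^sub>R g u) = v \<bullet> g v - t * (v \<bullet> g u) - t * (u \<bullet> g v) + t * t * (u \<bullet> g u)"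
      by (simp add: inner_diff algebra_simps)
    also have "v \<bullet> g v = 0" by (simp add: g_def c_def inner_diff_right vv)
    finally have "0 \<le> t * (t * (u \<bullet> g u) - 2 * (u \<bullet> u))"
      by (simp add: gu flip: u_def) (simp add: algebra_simps)
    then show ?thesis using that by (simp add: zero_le_mult_iff)
  qed
  note * = this
  have "u \<bullet> u \<le> 0"
  proof (rule ccontr)
    assume "\<not> u \<bullet> u \<le> 0"
    then have pos: "u \<bullet> u > 0" by linarith
    have "2 * (u \<bullet> u) \<le> u \<bullet> g u" using *[of 1] by simp
    then have p2: "u \<bullet> g u > 0" using pos by linarith
    \<comment> \<open>This choice of \<open>t\<close> makes the right-hand side equal to
      \<open>u \<bullet> u\<close>; the case \<open>t = 1\<close> has just shown that the
      denominator is positive.\<close>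
    have "2 * (u \<bullet> u) \<le> (u \<bullet> u) / (u \<bullet> g u) * (u \<bullet> g u)"
      by (rule *[OF divide_pos_pos[OF pos p2]])
    then show False using pos p2 by simp
  qed
  then have "u = 0" by (metis inner_ge_zero inner_eq_zero_iff antisym)
  then have "f v = c *\<^sub>R v" by (simp add: u_def g_def)
  with v show ?thesis using that by auto
qed

text \<open>Take an orthonormal set of eigenvectors of greatest cardinality, which exists because
  the dimension bounds all cardinalities. Its orthogonal complement is invariant under
  \<open>f\<close>, so a nonzero complement would contain one more unit eigenvector.\<close>

theorem selfadj_eigenbasis:
  fixes f :: "'a::euclidean_space \<Rightarrow> 'a"
  assumes f: "selfadj f"
  obtains E l where "onb E" "\<And>e. e \<in> E \<Longrightarrow> f e = l e *\<^sub>R e"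
proof -
  define P where "P E \<longleftrightarrow> finite E \<and> (\<forall>e\<in>E. norm e = 1) \<and> pairwise orthogonal E \<and> (\<forall>e\<in>E. \<exists>c. f e = c *\<^sub>R e)" for E
  have card: "card E < Suc DIM('a)" if "P E" for E
  proof -
    have "0 \<notin> E" using that by (force simp: P_def)
    then have "independent E"
      using that pairwise_orthogonal_independent by (auto simp: P_def)
    then show ?thesis using independent_bound by (auto simp: less_Suc_eq_le)
  qed
  have "P {}" by (simp add: P_def)
  from ex_has_greatest_nat[of P, OF this, of card "Suc DIM('a)"] card
  obtain E where E: "P E" and max: "\<And>E'. P E' \<Longrightarrow> card E' \<le> card E"
    by (meson less_imp_le)
  have orth: "orthogonal e e'" if "e \<in> E" "e' \<in> E" "e \<noteq> e'" for e e'
    using E that by (auto simp: P_def pairwise_def)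
  have inner: "e \<bullet> e' = (if e = e' then 1 else 0)" if "e \<in> E" "e' \<in> E" for e e'
    using E that orth by (auto simp: P_def orthogonal_def dot_square_norm)
  define W where "W = {w. \<forall>e\<in>E. e \<bullet> w = 0}"
  have W: "subspace W"
    by (auto simp: W_def subspace_def inner_add_right)
  have inv: "f w \<in> W" if "w \<in> W" for w
    unfolding W_def
  proof (intro CollectI ballI)
    fix e assume e: "e \<in> E"
    then obtain c where "f e = c *\<^sub>R e" using E by (auto simp: P_def)
    then have "f e \<bullet> w = 0" using that e by (simp add: W_def)
    then show "e \<bullet> f w = 0" using f by (simp add: selfadj_def)
  qed
  have W0: "W = {0}"
  proof (rule ccontr)
    assume "W \<noteq> {0}"
    then obtain v c where v: "v \<in> W" "norm v = 1" "f v = c *\<^sub>R v"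
      using selfadj_eigenvector_exists[OF f W _ inv] by blast
    have "v \<notin> E"
    proof
      assume "v \<in> E"
      then have "v \<bullet> v = 0" using v by (auto simp: W_def)
      then show False using v by simp
    qed
    moreover have "P (insert v E)"
      using E v by (auto simp: P_def pairwise_insert W_def orthogonal_def inner_commute)
    ultimately show False using max[of "insert v E"] E by (auto simp: P_def)
  qed
  have exp: "(\<Sum>e\<in>E. (v \<bullet> e) *\<^sub>R e) = v" for v
  proof -
    have "v - (\<Sum>e\<in>E. (v \<bullet> e) *\<^sub>R e) \<in> W"
      unfolding W_def
    proof (intro CollectI ballI)
      fix e' assume e': "e' \<in> E"
      have "e' \<bullet> (\<Sum>e\<in>E. (v \<bullet> e) *\<^sub>R e) = (\<Sum>e\<in>E. if e' = e then v \<bullet> e else 0)"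
        unfolding inner_sum_right by (intro sum.cong) (auto simp: inner e')
      also have "\<dots> = v \<bullet> e'" using e' E by (simp add: P_def)
      finally show "e' \<bullet> (v - (\<Sum>e\<in>E. (v \<bullet> e) *\<^sub>R e)) = 0"
        by (simp add: inner_diff_right inner_commute)
    qed
    then show ?thesis by (simp add: W0)
  qed
  have "onb E" using E exp by (auto simp: P_def onb_def)
  moreover obtain l where "\<And>e. e \<in> E \<Longrightarrow> f e = l e *\<^sub>R e"
    using E unfolding P_def by metis
  ultimately show ?thesis using that by blast
qed

lemma onb_inner:
  assumes "onb E" "e \<in> E" "e' \<in> E"
  shows "e \<bullet> e' = (if e = e' then 1 else 0)"
  using assms by (auto simp: onb_def orthogonal_def dot_square_norm pairwise_def)

lemma linear_eq_on_onb:
  assumes "onb E" "linear f" "linear g" "\<And>e. e \<in> E \<Longrightarrow> f e = g e"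
  shows "f v = g v"
proof -
  have v: "(\<Sum>e\<in>E. (v \<bullet> e) *\<^sub>R e) = v" using assms by (simp add: onb_def)
  have "f (\<Sum>e\<in>E. (v \<bullet> e) *\<^sub>R e) = g (\<Sum>e\<in>E. (v \<bullet> e) *\<^sub>R e)"
    using assms by (simp add: linear_sum linear_scale)
  then show ?thesis by (simp only: v)
qed

text \<open>Basis independence of the trace: expand the standard basis in \<open>E\<close>, exchange
  the sums, and contract back along the standard basis.\<close>

lemma rtrace_onb:
  fixes f :: "'a::euclidean_space \<Rightarrow> 'a"
  assumes "onb E" "linear f"
  shows "rtrace f = (\<Sum>e\<in>E. e \<bullet> f e)"
proof -
  have exp: "(\<Sum>e\<in>E. (b \<bullet> e) *\<^sub>R e) = b" for b using assms by (simp add: onb_def)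
  have "rtrace f = (\<Sum>b\<in>Basis. (\<Sum>e\<in>E. (b \<bullet> e) *\<^sub>R e) \<bullet> f b)"
    by (simp add: rtrace_def exp)
  also have "\<dots> = (\<Sum>b\<in>Basis. \<Sum>e\<in>E. (b \<bullet> e) * (e \<bullet> f b))"
    by (simp add: inner_sum_left)
  also have "\<dots> = (\<Sum>e\<in>E. \<Sum>b\<in>Basis. (b \<bullet> e) * (e \<bullet> f b))"
    by (rule sum.swap)
  also have "\<dots> = (\<Sum>e\<in>E. e \<bullet> f (\<Sum>b\<in>Basis. (e \<bullet> b) *\<^sub>R b))"
    using assms by (simp add: linear_sum linear_scale inner_sum_right inner_commute)
  finally show ?thesis by (simp add: euclidean_representation)
qed

text \<open>Since \<open>(B + sqrt l) (B - sqrt l) e = 0\<close>, the vector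
  \<open>w = B e - sqrt l *\<^sub>R e\<close> satisfies \<open>B w = - sqrt l *\<^sub>R w\<close>,
  which positivity of \<open>B\<close> rules out for \<open>l > 0\<close> unless
  \<open>w = 0\<close>. This pins down every positive root on the eigenvectors of its
  square.\<close>

lemma psd_sqrt_eigenvector:
  assumes B: "selfadj B" "\<And>v. 0 \<le> v \<bullet> B v" and e: "B (B e) = l *\<^sub>R e" and l: "l \<ge> 0"
  shows "B e = sqrt l *\<^sub>R e"
proof -
  have lin: "linear B" and sa: "\<And>x y. B x \<bullet> y = x \<bullet> B y"
    using B by (auto simp: selfadj_def)
  define w where "w = B e - sqrt l *\<^sub>R e"
  have Bw: "B w = - sqrt l *\<^sub>R w"
    using l by (simp add: w_def linear_diff[OF lin] linear_scale[OF lin] e scaleR_diff_right)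
  have "w = 0"
  proof (cases "l = 0")
    case True
    have "B e \<bullet> B e = e \<bullet> B (B e)" by (rule sa)
    then show ?thesis using True e by (simp add: w_def)
  next
    case False
    have "0 \<le> - sqrt l * (w \<bullet> w)" using B(2)[of w] by (simp add: Bw)
    moreover have "sqrt l > 0" using False l by simp
    ultimately have "w \<bullet> w \<le> 0" by (simp add: mult_le_0_iff)
    then show ?thesis by (metis inner_ge_zero inner_eq_zero_iff antisym)
  qed
  then show ?thesis by (simp add: w_def)
qed


section \<open>Complex matrices as real-linear operators\<close>

lemma linear_matrix_complex: "linear ((*v) (A :: complex^'n^'m))"
  by (rule linearI)
     (simp_all add: vec_eq_iff matrix_vector_mult_def scaleR_sum_right sum.distrib algebra_simps)

lemma inner_cadj: "(A *v v) \<bullet> w = v \<bullet> (cadj A *v w)" for A :: "complex^'n^'n"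
proof -
  have "(A *v v) \<bullet> w = (\<Sum>i\<in>UNIV. \<Sum>j\<in>UNIV. (A $ i $ j * v $ j) \<bullet> w $ i)"
    by (simp add: inner_vec_def matrix_vector_mult_def inner_sum_left)
  also have "\<dots> = (\<Sum>j\<in>UNIV. \<Sum>i\<in>UNIV. (A $ i $ j * v $ j) \<bullet> w $ i)"
    by (rule sum.swap)
  also have "\<dots> = (\<Sum>j\<in>UNIV. \<Sum>i\<in>UNIV. v $ j \<bullet> (cnj (A $ i $ j) * w $ i))"
    by (intro sum.cong refl) (simp add: inner_complex_def algebra_simps)
  also have "\<dots> = v \<bullet> (cadj A *v w)"
    by (simp add: inner_vec_def matrix_vector_mult_def inner_sum_right cadj_def)
  finally show ?thesis .
qed

lemma hermitian_iff_selfadj: "hermitian A \<longleftrightarrow> selfadj ((*v) A)"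
proof
  assume "hermitian A"
  then show "selfadj ((*v) A)"
    using inner_cadj[of A] linear_matrix_complex[of A] by (simp add: selfadj_def hermitian_def)
next
  assume "selfadj ((*v) A)"
  then have "v \<bullet> (cadj A *v w) = v \<bullet> (A *v w)" for v w
    using inner_cadj[of A v w] by (simp add: selfadj_def)
  then have "cadj A *v w = A *v w" for w
    by (metis vector_eq_ldot)
  then show "hermitian A" by (simp add: hermitian_def matrix_eq)
qed

lemma psd_iff: "psd A \<longleftrightarrow> selfadj ((*v) A) \<and> (\<forall>v. 0 \<le> v \<bullet> (A *v v))"
proof -
  have "Re (\<Sum>i\<in>UNIV. cnj (v $ i) * (A *v v) $ i) = v \<bullet> (A *v v)" for v
    by (simp add: inner_vec_def inner_complex_def)
  then show ?thesis by (simp add: psd_def hermitian_iff_selfadj)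
qed

text \<open>The real basis has two vectors per coordinate, the axis vectors with entry
  \<open>1\<close> and \<open>\<i>\<close>, and each contributes the real part of the diagonal
  entry.\<close>

lemma rtrace_matrix: "rtrace ((*v) A) = 2 * Re (ctrace A)" for A :: "complex^'n^'n"
proof -
  have col: "(A *v axis i b) $ i = A $ i $ i * b" for i b
    by (simp add: matrix_vector_mult_def axis_def if_distrib cong: if_cong)
  have inj: "inj_on (\<lambda>(i,b). axis i b :: complex^'n) (UNIV \<times> Basis)"
    by (auto simp: inj_on_def axis_eq_axis nonzero_Basis)
  have "rtrace ((*v) A) = (\<Sum>(i,b)\<in>UNIV \<times> Basis. axis i b \<bullet> (A *v axis i b))"
  proof -
    have "(Basis :: (complex^'n) set) = (\<lambda>(i,b). axis i b) ` (UNIV \<times> Basis)"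
      by (auto simp: Basis_vec_def)
    then show ?thesis
      unfolding rtrace_def using sum.reindex[OF inj, of "\<lambda>b. b \<bullet> (A *v b)"]
      by (simp add: o_def case_prod_unfold)
  qed
  also have "\<dots> = (\<Sum>i\<in>UNIV. \<Sum>b\<in>Basis. axis i b \<bullet> (A *v axis i b))"
    by (simp add: sum.cartesian_product)
  also have "\<dots> = (\<Sum>i\<in>UNIV. \<Sum>b\<in>Basis. b \<bullet> (A $ i $ i * b))"
    by (simp add: inner_axis' col)
  also have "\<dots> = (\<Sum>i\<in>UNIV. 2 * Re (A $ i $ i))"
    by (simp add: Basis_complex_def inner_complex_def)
  finally show ?thesis by (simp add: ctrace_def sum_distrib_left)
qed

section \<open>Spectral square roots of positive semidefinite matrices\<close>

lemma psd_eigenbasis: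
  fixes A :: "complex^'n^'n"
  assumes "psd A"
  obtains E l where "onb E" "\<And>e. e \<in> E \<Longrightarrow> A *v e = l e *\<^sub>R e" "\<And>e. e \<in> E \<Longrightarrow> l e \<ge> 0"
proof -
  from assms have sa: "selfadj ((*v) A)" by (simp add: psd_iff)
  obtain E l where El: "onb E" "\<And>e. e \<in> E \<Longrightarrow> A *v e = l e *\<^sub>R e"
    using selfadj_eigenbasis[OF sa] by blast
  have "l e \<ge> 0" if "e \<in> E" for e
  proof -
    have "0 \<le> e \<bullet> (A *v e)" using assms by (simp add: psd_iff)
    also have "\<dots> = l e" using El that onb_inner[OF El(1) that that] by simp
    finally show ?thesis .
  qed
  then show ?thesis using El that by blast
qed

text \<open>The root is built spectrally as a real-linear map \<open>f\<close>. Only complex-linear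
  maps are given by matrices, so commutation with complex scalars has to be proved before
  \<open>matrix f\<close> represents \<open>f\<close>.\<close>

lemma sqrt_matrix_exists:
  fixes A :: "complex^'n^'n"
  assumes "psd A"
  obtains B where "psd B" "B ** B = A"
proof -
  obtain E l where onb: "onb E" and ev: "\<And>e. e \<in> E \<Longrightarrow> A *v e = l e *\<^sub>R e" and l: "\<And>e. e \<in> E \<Longrightarrow> l e \<ge> 0"
    using psd_eigenbasis[OF assms] by blast
  have finE: "finite E" using onb by (simp add: onb_def)
  define f where "f v = (\<Sum>e\<in>E. (sqrt (l e) * (v \<bullet> e)) *\<^sub>R e)" for v
  have lin: "linear f"
    by (rule linearI)
       (simp_all add: f_def inner_add_left algebra_simps sum.distrib scaleR_sum_right)
  have sa: "selfadj f"
    unfolding selfadj_def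
  proof (intro conjI allI lin)
    fix x y show "f x \<bullet> y = x \<bullet> f y"
      unfolding f_def inner_sum_left inner_sum_right
      by (intro sum.cong) (simp_all add: inner_commute)
  qed
  have pos: "0 \<le> v \<bullet> f v" for v
    unfolding f_def inner_sum_right
    by (intro sum_nonneg) (simp add: l mult.assoc)
  have fe: "f e = sqrt (l e) *\<^sub>R e" if "e \<in> E" for e
  proof -
    have "f e = (\<Sum>e'\<in>E. if e' = e then sqrt (l e) *\<^sub>R e else 0)"
      unfolding f_def by (intro sum.cong) (simp_all add: onb_inner[OF onb that])
    then show ?thesis using that finE by simp
  qed
  have ff: "f (f v) = A *v v" for v
    by (rule linear_eq_on_onb[OF onb, of "\<lambda>v. f (f v)"])
       (use lin linear_compose[OF lin lin] in \<open>simp_all add: o_def linear_matrix_complex fe linear_scale ev l\<close>)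
  \<comment> \<open>The square root commutes with multiplication by \<open>\<i>\<close> because \<open>\<i>\<close> preserves the eigenspaces.\<close>
  have lini: "linear (\<lambda>v. \<i> *s v :: complex^'n)"
    by (rule linearI) (simp_all add: vec_eq_iff algebra_simps)
  have fi: "f (\<i> *s v) = \<i> *s f v" for v
  proof (rule linear_eq_on_onb[OF onb, of "\<lambda>v. f (\<i> *s v)"])
    show "linear (\<lambda>v. f (\<i> *s v))" using linear_compose[OF lini lin] by (simp add: o_def)
    show "linear (\<lambda>v. \<i> *s f v)" using linear_compose[OF lin lini] by (simp add: o_def)
    fix e assume e: "e \<in> E"
    have "A *v (\<i> *s e) = \<i> *s (A *v e)"
      by (simp add: vec_eq_iff matrix_vector_mult_def sum_distrib_left algebra_simps)
    then have "f (f (\<i> *s e)) = l e *\<^sub>R (\<i> *s e)"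
      by (simp add: ff ev[OF e] linear_scale[OF lini])
    then have "f (\<i> *s e) = sqrt (l e) *\<^sub>R (\<i> *s e)"
      using psd_sqrt_eigenvector[OF sa pos] l[OF e] by blast
    then show "f (\<i> *s e) = \<i> *s f e" by (simp add: fe[OF e] linear_scale[OF lini])
  qed
  have fc: "f (c *s v) = c *s f v" for c v
  proof -
    have dec: "c *s w = Re c *\<^sub>R w + Im c *\<^sub>R (\<i> *s w)" for w :: "complex^'n"
      by (simp add: vec_eq_iff complex_eq_iff)
    show ?thesis unfolding dec
      by (simp add: linear_add[OF lin] linear_scale[OF lin] fi)
  qed
  have "Vector_Spaces.linear (*s) (*s) f"
    by unfold_locales (simp_all add: linear_add[OF lin] fc algebra_simps)
  then have mf: "matrix f *v v = f v" for v
    by (rule matrix_works)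
  then have "(*v) (matrix f) = f" by blast
  then have "psd (matrix f)" using sa pos by (simp add: psd_iff)
  moreover have "matrix f ** matrix f = A"
    by (simp add: matrix_eq matrix_vector_mul_assoc[symmetric] mf ff)
  ultimately show ?thesis by (rule that)
qed

lemma psd_sqrt_matrix_eigenvector:
  fixes A B :: "complex^'n^'n"
  assumes "psd B" "B ** B = A" "A *v e = l *\<^sub>R e" "l \<ge> 0"
  shows "B *v e = sqrt l *\<^sub>R e"
  using assms psd_sqrt_eigenvector[of "(*v) B" e l]
  by (simp add: psd_iff matrix_vector_mul_assoc)

text \<open>Both roots must multiply each eigenvector of \<open>A\<close> by the square root of its
  eigenvalue, hence they agree on an orthonormal basis.\<close>

lemma psd_sqrt_matrix_unique:
  fixes A B C :: "complex^'n^'n"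
  assumes "psd A" "psd B" "B ** B = A" "psd C" "C ** C = A"
  shows "B = C"
proof -
  obtain E l where onb: "onb E" and ev: "\<And>e. e \<in> E \<Longrightarrow> A *v e = l e *\<^sub>R e" and l: "\<And>e. e \<in> E \<Longrightarrow> l e \<ge> 0"
    using psd_eigenbasis[OF assms(1)] by blast
  have "B *v v = C *v v" for v
    by (rule linear_eq_on_onb[OF onb linear_matrix_complex linear_matrix_complex])
       (use assms ev l psd_sqrt_matrix_eigenvector in metis)
  then show ?thesis by (simp add: matrix_eq)
qed

text \<open>Existence and uniqueness together make the definite description behind
  \<open>msqrt\<close> denote the intended root.\<close>

lemma msqrt:
  assumes "psd A"
  shows "psd (msqrt A)" "msqrt A ** msqrt A = A"
proof -
  obtain B where B: "psd B" "B ** B = A" using sqrt_matrix_exists[OF assms] by blast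
  have "psd (msqrt A) \<and> msqrt A ** msqrt A = A"
    unfolding msqrt_def by (rule theI[of _ B]) (use B psd_sqrt_matrix_unique[OF assms] in auto)
  then show "psd (msqrt A)" "msqrt A ** msqrt A = A" by auto
qed

text \<open>The basis is orthonormal over the reals, so every eigenvalue occurs with twice its
  complex multiplicity; this is the source of the division by 2.\<close>

lemma ctrace_msqrt:
  assumes "psd A" "onb E" "\<And>e. e \<in> E \<Longrightarrow> A *v e = l e *\<^sub>R e" "\<And>e. e \<in> E \<Longrightarrow> l e \<ge> 0"
  shows "Re (ctrace (msqrt A)) = (\<Sum>e\<in>E. sqrt (l e)) / 2"
proof -
  have "2 * Re (ctrace (msqrt A)) = (\<Sum>e\<in>E. e \<bullet> (msqrt A *v e))"
    using rtrace_matrix[of "msqrt A"] rtrace_onb[OF assms(2) linear_matrix_complex] by metis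
  also have "\<dots> = (\<Sum>e\<in>E. sqrt (l e))"
  proof (intro sum.cong refl)
    fix e assume e: "e \<in> E"
    show "e \<bullet> (msqrt A *v e) = sqrt (l e)"
      using psd_sqrt_matrix_eigenvector[OF msqrt[OF assms(1)] assms(3)[OF e] assms(4)[OF e]]
        onb_inner[OF assms(2) e e] by simp
  qed
  finally show ?thesis by simp
qed

text \<open>In an eigenbasis of \<open>B\<close> the trace becomes a sum of eigenvalues of
  \<open>B\<close> times values of the quadratic form of \<open>A\<close>.\<close>

lemma trace_mult_nonneg:
  assumes "psd A" "psd B"
  shows "0 \<le> Re (ctrace (A ** B))"
proof -
  obtain E l where onb: "onb E" and ev: "\<And>e. e \<in> E \<Longrightarrow> B *v e = l e *\<^sub>R e" and l: "\<And>e. e \<in> E \<Longrightarrow> l e \<ge> 0"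
    using psd_eigenbasis[OF assms(2)] by blast
  have "2 * Re (ctrace (A ** B)) = (\<Sum>e\<in>E. e \<bullet> ((A ** B) *v e))"
    using rtrace_matrix[of "A ** B"] rtrace_onb[OF onb linear_matrix_complex] by metis
  also have "\<dots> = (\<Sum>e\<in>E. l e * (e \<bullet> (A *v e)))"
    by (intro sum.cong) (simp_all add: matrix_vector_mul_assoc[symmetric] ev linear_scale[OF linear_matrix_complex])
  also have "\<dots> \<ge> 0" using assms l by (intro sum_nonneg mult_nonneg_nonneg) (auto simp: psd_iff)
  finally show ?thesis by simp
qed

text \<open>The eigenvalues are nonnegative and, counted over a real basis, sum to 2. The crude
  constant suffices because the estimate only serves to show that suprema over parameters are
  bounded.\<close>

lemma norm_density_mult_le:
  assumes "density_matrix A"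
  shows "norm (A *v v) \<le> 2 * norm v"
proof -
  have psd: "psd A" using assms by (simp add: density_matrix_def)
  obtain E l where onb: "onb E" and ev: "\<And>e. e \<in> E \<Longrightarrow> A *v e = l e *\<^sub>R e" and l: "\<And>e. e \<in> E \<Longrightarrow> l e \<ge> 0"
    using psd_eigenbasis[OF psd] by blast
  have "(\<Sum>e\<in>E. l e) = (\<Sum>e\<in>E. e \<bullet> (A *v e))"
    by (intro sum.cong) (simp_all add: ev onb_inner[OF onb])
  also have "\<dots> = 2"
    using rtrace_matrix[of A] rtrace_onb[OF onb linear_matrix_complex] assms
    by (metis density_matrix_def mult.right_neutral one_complex.simps(1))
  finally have l2: "(\<Sum>e\<in>E. l e) = 2" .
  have "A *v v = A *v (\<Sum>e\<in>E. (v \<bullet> e) *\<^sub>R e)" using onb by (simp add: onb_def)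
  also have "\<dots> = (\<Sum>e\<in>E. (l e * (v \<bullet> e)) *\<^sub>R e)"
    by (simp add: linear_sum[OF linear_matrix_complex] linear_scale[OF linear_matrix_complex] ev mult.commute cong: sum.cong)
  also have "norm \<dots> \<le> (\<Sum>e\<in>E. l e * norm v)"
  proof (rule sum_norm_le)
    fix e assume e: "e \<in> E"
    then have "norm e = 1" using onb by (simp add: onb_def)
    then show "norm ((l e * (v \<bullet> e)) *\<^sub>R e) \<le> l e * norm v"
      using Cauchy_Schwarz_ineq2[of v e] l[OF e] by (simp add: abs_mult mult_left_mono)
  qed
  also have "\<dots> = 2 * norm v" by (simp add: sum_distrib_right[symmetric] l2)
  finally show ?thesis .
qed

section \<open>Product distributions and McDiarmid's inequality\<close>

lemma expectation_mono_finite: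
  fixes f g :: "'a \<Rightarrow> real"
  assumes "finite (set_pmf p)" "\<And>x. x \<in> set_pmf p \<Longrightarrow> f x \<le> g x"
  shows "measure_pmf.expectation p f \<le> measure_pmf.expectation p g"
  using assms by (intro integral_mono_AE integrable_measure_pmf_finite) (auto simp: AE_measure_pmf_iff)

lemma expectation_pair_pmf:
  fixes f :: "'a \<times> 'b \<Rightarrow> real"
  assumes "finite (set_pmf p)" "finite (set_pmf q)"
  shows "measure_pmf.expectation (pair_pmf p q) f
    = measure_pmf.expectation p (\<lambda>a. measure_pmf.expectation q (\<lambda>b. f (a, b)))"
proof -
  have "pair_pmf p q = bind_pmf p (\<lambda>a. map_pmf (Pair a) q)"
    by (simp add: pair_pmf_def map_pmf_def)
  then have "measure_pmf.expectation (pair_pmf p q) f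
     = (\<Sum>a\<in>set_pmf p. pmf p a *\<^sub>R measure_pmf.expectation (map_pmf (Pair a) q) f)"
    using assms by (simp add: pmf_expectation_bind[where A = "set_pmf p"])
  also have "\<dots> = measure_pmf.expectation p (\<lambda>a. measure_pmf.expectation q (\<lambda>b. f (a, b)))"
    using assms by (simp add: integral_measure_pmf[where A = "set_pmf p"])
  finally show ?thesis .
qed

lemma expectation_swap:
  fixes f :: "'a \<Rightarrow> 'b \<Rightarrow> real"
  assumes "finite (set_pmf p)" "finite (set_pmf q)"
  shows "measure_pmf.expectation p (\<lambda>a. measure_pmf.expectation q (f a))
    = measure_pmf.expectation q (\<lambda>b. measure_pmf.expectation p (\<lambda>a. f a b))"
  using expectation_pair_pmf[OF assms, of "\<lambda>(a, b). f a b"]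
    expectation_pair_pmf[OF assms(2,1), of "\<lambda>(b, a). f a b"]
  by (subst (asm) pair_commute_pmf) (simp add: case_prod_unfold)

section \<open>Expectations over i.i.d. samples\<close>

lemma finite_set_sample_pmf:
  "finite (set_pmf p) \<Longrightarrow> finite (set_pmf (sample_pmf N p))"
  by (auto simp: sample_pmf_def set_Pi_pmf intro!: finite_PiE_dflt)

lemma sample_pmf_mem:
  "D \<in> set_pmf (sample_pmf N p) \<Longrightarrow> j < N \<Longrightarrow> D j \<in> set_pmf p"
  by (auto simp: sample_pmf_def set_Pi_pmf PiE_dflt_def)

lemma sample_pmf_0: "sample_pmf 0 p = return_pmf (\<lambda>_. undefined)"
  by (simp add: sample_pmf_def)

text \<open>Integrating out the last coordinate innermost is the recursion used by all later
  inductions on the sample size.\<close>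

lemma expectation_sample_Suc:
  fixes f :: "(nat \<Rightarrow> 'a) \<Rightarrow> real"
  assumes "finite (set_pmf p)"
  shows "measure_pmf.expectation (sample_pmf (Suc N) p) f
    = measure_pmf.expectation (sample_pmf N p) (\<lambda>D. measure_pmf.expectation p (\<lambda>a. f (D(N := a))))"
proof -
  have "sample_pmf (Suc N) p = map_pmf (\<lambda>(y, f). f(N := y)) (pair_pmf p (sample_pmf N p))"
    by (simp add: sample_pmf_def lessThan_Suc Pi_pmf_insert)
  then have "measure_pmf.expectation (sample_pmf (Suc N) p) f
    = measure_pmf.expectation (pair_pmf p (sample_pmf N p)) (\<lambda>(y, D). f (D(N := y)))"
    by (simp add: case_prod_unfold)
  also have "\<dots> = measure_pmf.expectation p (\<lambda>y. measure_pmf.expectation (sample_pmf N p) (\<lambda>D. f (D(N := y))))"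
    using assms by (simp add: expectation_pair_pmf finite_set_sample_pmf)
  also have "\<dots> = measure_pmf.expectation (sample_pmf N p) (\<lambda>D. measure_pmf.expectation p (\<lambda>a. f (D(N := a))))"
    using assms by (rule expectation_swap) (simp add: finite_set_sample_pmf assms)
  finally show ?thesis .
qed

lemma expectation_sample_sum:
  fixes h :: "'a \<Rightarrow> real"
  assumes p: "finite (set_pmf p)"
  shows "measure_pmf.expectation (sample_pmf N p) (\<lambda>D. \<Sum>j<N. h (D j)) = real N * measure_pmf.expectation p h"
proof (induction N)
  case 0
  then show ?case by (simp add: sample_pmf_0)
next
  case (Suc N)
  have "measure_pmf.expectation (sample_pmf (Suc N) p) (\<lambda>D. \<Sum>j<Suc N. h (D j))
    = measure_pmf.expectation (sample_pmf N p) (\<lambda>D. measure_pmf.expectation p (\<lambda>a. (\<Sum>j<N. h (D j)) + h a))"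
    by (simp add: expectation_sample_Suc[OF p] cong: sum.cong_simp)
  also have "\<dots> = measure_pmf.expectation (sample_pmf N p) (\<lambda>D. (\<Sum>j<N. h (D j)) + measure_pmf.expectation p h)"
    using p by (simp add: integrable_measure_pmf_finite)
  also have "\<dots> = real N * measure_pmf.expectation p h + measure_pmf.expectation p h"
    using p by (simp add: integrable_measure_pmf_finite finite_set_sample_pmf Suc del: Bochner_Integration.integral_sum)
  finally show ?case by (simp add: algebra_simps)
qed

text \<open>Samples take the value \<open>undefined\<close> outside the index range, so the
  transformed sample must be reset to that default instead of being \<open>h o T\<close>.\<close>

lemma expectation_sample_map:
  fixes f :: "(nat \<Rightarrow> 'b) \<Rightarrow> real"
  assumes q: "finite (set_pmf q)"
  shows "measure_pmf.expectation (sample_pmf N (map_pmf h q)) f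
    = measure_pmf.expectation (sample_pmf N q) (\<lambda>T. f (\<lambda>j. if j < N then h (T j) else undefined))"
proof (induction N arbitrary: f)
  case 0
  then show ?case by (simp add: sample_pmf_0)
next
  case (Suc N)
  have eq: "(\<lambda>j. if j < N then h (T j) else undefined)(N := h a)
      = (\<lambda>j. if j < Suc N then h ((T(N := a)) j) else undefined)" for T a
    by (auto simp: fun_eq_iff)
  show ?case
    using q by (simp only: expectation_sample_Suc finite_imageI set_map_pmf Suc integral_map_pmf eq)
qed

lemma expectation_sample_pair:
  fixes f :: "(nat \<Rightarrow> 'a \<times> 'b) \<Rightarrow> real"
  assumes p: "finite (set_pmf p)" and q: "finite (set_pmf q)"
  shows "measure_pmf.expectation (sample_pmf N (pair_pmf p q)) f
    = measure_pmf.expectation (sample_pmf N p) (\<lambda>D. measure_pmf.expectation (sample_pmf N q)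
        (\<lambda>D'. f (\<lambda>j. if j < N then (D j, D' j) else undefined)))"
proof (induction N arbitrary: f)
  case 0
  then show ?case by (simp add: sample_pmf_0)
next
  case (Suc N)
  have eq: "(\<lambda>j. if j < N then (D j, D' j) else undefined)(N := (a, b))
      = (\<lambda>j. if j < Suc N then ((D(N := a)) j, (D'(N := b)) j) else undefined)" for D D' a b
    by (auto simp: fun_eq_iff)
  have pq: "finite (set_pmf (pair_pmf p q))" using p q by simp
  show ?case
    unfolding expectation_sample_Suc[OF pq] expectation_sample_Suc[OF p] expectation_sample_Suc[OF q]
      Suc expectation_pair_pmf[OF p q] eq
    by (subst expectation_swap[OF p finite_set_sample_pmf[OF q]]) (rule refl)
qed

section \<open>Concentration under bounded differences\<close>

lemma Hoeffdings_lemma_finite: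
  fixes f :: "'a \<Rightarrow> real"
  assumes p: "finite (set_pmf p)" and c: "\<And>a b. a \<in> set_pmf p \<Longrightarrow> b \<in> set_pmf p \<Longrightarrow> f a - f b \<le> c" and l: "l > 0"
  shows "measure_pmf.expectation p (\<lambda>a. exp (l * (f a - measure_pmf.expectation p f))) \<le> exp (l\<^sup>2 * c\<^sup>2 / 8)"
proof -
  define m where "m = Min (f ` set_pmf p)"
  have m: "m \<le> f a" if "a \<in> set_pmf p" for a using that p by (simp add: m_def)
  have "m \<in> f ` set_pmf p" unfolding m_def using p by (intro Min_in) (auto simp: set_pmf_not_empty)
  then have m': "f a \<le> m + c" if "a \<in> set_pmf p" for a using c that by (force simp: algebra_simps)
  interpret interval_bounded_random_variable "measure_pmf p" f m "m + c"
    by unfold_locales (use m m' in \<open>auto simp: AE_measure_pmf_iff\<close>)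
  have "ennreal (measure_pmf.expectation p (\<lambda>a. exp (l * (f a - measure_pmf.expectation p f))))
      = nn_integral p (\<lambda>a. exp (l * (f a - measure_pmf.expectation p f)))"
    using p by (intro nn_integral_eq_integral[symmetric] integrable_measure_pmf_finite) auto
  also have "\<dots> \<le> ennreal (exp (l\<^sup>2 * c\<^sup>2 / 8))"
    using Hoeffdings_lemma_nn_integral[OF l] by simp
  finally show ?thesis by simp
qed

text \<open>Martingale argument by induction: \<open>g\<close> is the conditional expectation given
  all but the last coordinate. The deviation of \<open>f\<close> from \<open>g\<close> is handled by
  Hoeffding's lemma in that single coordinate, at the price of one factor
  \<open>exp (l\<^sup>2 * c\<^sup>2 / 8)\<close>.\<close>

lemma bounded_differences_mgf:
  fixes f :: "(nat \<Rightarrow> 'a) \<Rightarrow> real"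
  assumes p: "finite (set_pmf p)" and l: "l > 0"
    and bd: "\<And>D j a. j < N \<Longrightarrow> \<bar>f (D(j := a)) - f D\<bar> \<le> c"
  shows "measure_pmf.expectation (sample_pmf N p)
     (\<lambda>D. exp (l * (f D - measure_pmf.expectation (sample_pmf N p) f))) \<le> exp (l\<^sup>2 * (real N * c\<^sup>2) / 8)"
  using bd
proof (induction N arbitrary: f)
  case 0
  then show ?case by (simp add: sample_pmf_0)
next
  case (Suc N)
  define g where "g D = measure_pmf.expectation p (\<lambda>a. f (D(N := a)))" for D
  define \<mu> where "\<mu> = measure_pmf.expectation (sample_pmf N p) g"
  have int: "integrable p h" for h :: "'a \<Rightarrow> real" using p by (rule integrable_measure_pmf_finite)
  have mu: "measure_pmf.expectation (sample_pmf (Suc N) p) f = \<mu>"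
    by (simp add: expectation_sample_Suc[OF p] \<mu>_def g_def[abs_def])
  \<comment> \<open>Averaging over the last coordinate preserves the difference bound, so the
    induction hypothesis applies to \<open>g\<close>.\<close>
  have gbd: "\<bar>g (D(j := b)) - g D\<bar> \<le> c" if j: "j < N" for D j b
  proof -
    have "(D(j := b))(N := a) = (D(N := a))(j := b)" for a
      using j by (intro fun_upd_twist) simp
    then have "\<bar>f ((D(j := b))(N := a)) - f (D(N := a))\<bar> \<le> c" for a
      using Suc.prems[OF less_SucI[OF j], of "D(N := a)" b] by (simp only:)
    then have "measure_pmf.expectation p (\<lambda>a. \<bar>f ((D(j := b))(N := a)) - f (D(N := a))\<bar>) \<le> measure_pmf.expectation p (\<lambda>_. c)"
      using p by (intro expectation_mono_finite) auto
    moreover have "\<bar>g (D(j := b)) - g D\<bar> \<le> measure_pmf.expectation p (\<lambda>a. \<bar>f ((D(j := b))(N := a)) - f (D(N := a))\<bar>)"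
      unfolding g_def by (subst Bochner_Integration.integral_diff[symmetric]) (auto intro!: int integral_abs_bound)
    ultimately show ?thesis by simp
  qed
  have "measure_pmf.expectation (sample_pmf (Suc N) p) (\<lambda>D. exp (l * (f D - \<mu>)))
    = measure_pmf.expectation (sample_pmf N p) (\<lambda>D. measure_pmf.expectation p (\<lambda>a. exp (l * (g D - \<mu>)) * exp (l * (f (D(N := a)) - g D))))"
    by (simp add: expectation_sample_Suc[OF p] exp_add[symmetric] algebra_simps)
  also have "\<dots> = measure_pmf.expectation (sample_pmf N p) (\<lambda>D. exp (l * (g D - \<mu>)) * measure_pmf.expectation p (\<lambda>a. exp (l * (f (D(N := a)) - g D))))"
    by simp
  also have "\<dots> \<le> measure_pmf.expectation (sample_pmf N p) (\<lambda>D. exp (l * (g D - \<mu>)) * exp (l\<^sup>2 * c\<^sup>2 / 8))"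
  proof (intro expectation_mono_finite finite_set_sample_pmf p mult_left_mono)
    fix D
    have "f (D(N := a)) - f (D(N := b)) \<le> c" for a b
      using Suc.prems[OF lessI, of "D(N := b)" a] unfolding fun_upd_upd by linarith
    then show "measure_pmf.expectation p (\<lambda>a. exp (l * (f (D(N := a)) - g D))) \<le> exp (l\<^sup>2 * c\<^sup>2 / 8)"
      unfolding g_def using p l by (intro Hoeffdings_lemma_finite)
  qed simp
  also have "\<dots> = measure_pmf.expectation (sample_pmf N p) (\<lambda>D. exp (l * (g D - \<mu>))) * exp (l\<^sup>2 * c\<^sup>2 / 8)"
    by simp
  also have "\<dots> \<le> exp (l\<^sup>2 * (real N * c\<^sup>2) / 8) * exp (l\<^sup>2 * c\<^sup>2 / 8)"
    unfolding \<mu>_def by (intro mult_right_mono Suc.IH gbd) auto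
  also have "\<dots> = exp (l\<^sup>2 * (real (Suc N) * c\<^sup>2) / 8)"
    by (simp add: exp_add[symmetric] field_simps)
  finally show ?case unfolding mu .
qed

theorem McDiarmid_inequality:
  fixes f :: "(nat \<Rightarrow> 'a) \<Rightarrow> real"
  assumes p: "finite (set_pmf p)" and N: "N > 0" and c: "c > 0" and t: "t > 0"
    and bd: "\<And>D j a. j < N \<Longrightarrow> \<bar>f (D(j := a)) - f D\<bar> \<le> c"
  shows "measure_pmf.prob (sample_pmf N p) {D. f D > measure_pmf.expectation (sample_pmf N p) f + t}
     \<le> exp (- 2 * t\<^sup>2 / (real N * c\<^sup>2))"
proof -
  let ?S = "sample_pmf N p"
  define \<mu> where "\<mu> = measure_pmf.expectation ?S f"
  \<comment> \<open>The minimizer of the Chernoff exponent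
    \<open>- l * t + l\<^sup>2 * (real N * c\<^sup>2) / 8\<close>.\<close>
  define l where "l = 4 * t / (real N * c\<^sup>2)"
  have l: "l > 0" using N c t by (simp add: l_def)
  have "measure_pmf.prob ?S {D. f D > \<mu> + t} = measure_pmf.expectation ?S (indicator {D. f D > \<mu> + t})"
    by simp
  also have "\<dots> \<le> measure_pmf.expectation ?S (\<lambda>D. exp (- l * t) * exp (l * (f D - \<mu>)))"
  proof (intro expectation_mono_finite finite_set_sample_pmf p)
    fix D
    have "l * (\<mu> + t) \<le> l * f D" if "f D > \<mu> + t" using l that by (intro mult_left_mono) auto
    then show "indicator {D. f D > \<mu> + t} D \<le> exp (- l * t) * exp (l * (f D - \<mu>))"
      by (auto simp: exp_add[symmetric] indicator_def algebra_simps)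
  qed
  also have "\<dots> = exp (- l * t) * measure_pmf.expectation ?S (\<lambda>D. exp (l * (f D - \<mu>)))"
    by simp
  also have "\<dots> \<le> exp (- l * t) * exp (l\<^sup>2 * (real N * c\<^sup>2) / 8)"
    unfolding \<mu>_def using bounded_differences_mgf[OF p l bd] by (intro mult_left_mono) auto
  also have "\<dots> = exp (- l * t + l\<^sup>2 * (real N * c\<^sup>2) / 8)" by (simp only: exp_add)
  also have "- l * t + l\<^sup>2 * (real N * c\<^sup>2) / 8 = - 2 * t\<^sup>2 / (real N * c\<^sup>2)"
    using N c by (simp add: l_def field_simps power2_eq_square)
  finally show ?thesis unfolding \<mu>_def .
qed

text \<open>Independent centred vectors are orthogonal in mean square, so cross terms vanish.
  Centring is expressed through inner products so that only real-valued expectations occur.\<close>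

lemma expectation_norm_sum_sq:
  fixes X :: "'a \<Rightarrow> 'v::real_inner"
  assumes q: "finite (set_pmf q)" and zero: "\<And>t. measure_pmf.expectation q (\<lambda>a. X a \<bullet> t) = 0"
  shows "measure_pmf.expectation (sample_pmf N q) (\<lambda>S. (norm (\<Sum>j<N. X (S j)))\<^sup>2)
     = real N * measure_pmf.expectation q (\<lambda>a. (norm (X a))\<^sup>2)"
proof (induction N)
  case 0
  then show ?case by (simp add: sample_pmf_0)
next
  case (Suc N)
  let ?m = "measure_pmf.expectation q (\<lambda>a. (norm (X a))\<^sup>2)"
  have int: "integrable q h" for h :: "'a \<Rightarrow> real" using q by (rule integrable_measure_pmf_finite)
  have int2: "integrable (sample_pmf N q) h" for h :: "_ \<Rightarrow> real"
    using q by (intro integrable_measure_pmf_finite finite_set_sample_pmf)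
  have eq: "(norm (T + X a))\<^sup>2 = (norm T)\<^sup>2 + 2 * (X a \<bullet> T) + (norm (X a))\<^sup>2" for T a
    by (simp add: power2_norm_eq_inner inner_add inner_commute)
  have in': "measure_pmf.expectation q (\<lambda>a. (norm (T + X a))\<^sup>2) = (norm T)\<^sup>2 + ?m" for T
    unfolding eq by (simp add: int zero)
  have "measure_pmf.expectation (sample_pmf (Suc N) q) (\<lambda>S. (norm (\<Sum>j<Suc N. X (S j)))\<^sup>2)
    = measure_pmf.expectation (sample_pmf N q) (\<lambda>S. measure_pmf.expectation q (\<lambda>a. (norm ((\<Sum>j<N. X (S j)) + X a))\<^sup>2))"
    by (simp add: expectation_sample_Suc[OF q] cong: sum.cong_simp)
  also have "\<dots> = measure_pmf.expectation (sample_pmf N q) (\<lambda>S. (norm (\<Sum>j<N. X (S j)))\<^sup>2 + ?m)"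
    by (simp add: in')
  also have "\<dots> = real N * ?m + ?m" by (simp add: int2 Suc)
  finally show ?case by (simp add: algebra_simps)
qed

lemma expectation_le_sqrt:
  fixes Y :: "'a \<Rightarrow> real"
  assumes q: "finite (set_pmf q)"
  shows "measure_pmf.expectation q Y \<le> sqrt (measure_pmf.expectation q (\<lambda>a. (Y a)\<^sup>2))"
proof -
  have int: "integrable q h" for h :: "'a \<Rightarrow> real" using q by (rule integrable_measure_pmf_finite)
  have "0 \<le> measure_pmf.variance q Y" by simp
  also have "\<dots> = measure_pmf.expectation q (\<lambda>a. (Y a)\<^sup>2) - (measure_pmf.expectation q Y)\<^sup>2"
    by (intro measure_pmf.variance_eq int)
  finally show ?thesis by (intro real_le_rsqrt) simp
qed

section \<open>Symmetrization\<close>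

text \<open>Common form of both complexities: the index runs over the measurements for a fixed
  parameter, or over pairs of a parameter and a measurement.\<close>

definition rad_class :: "nat \<Rightarrow> 'a pmf \<Rightarrow> 'i set \<Rightarrow> ('i \<Rightarrow> 'a \<Rightarrow> real) \<Rightarrow> real" where
  "rad_class N p I g = measure_pmf.expectation (sample_pmf N (pair_pmf p rademacher))
     (\<lambda>S. SUP i\<in>I. (\<Sum>j<N. snd (S j) * g i (fst (S j))) / sqrt (real N))"

lemma set_pmf_rademacher: "set_pmf rademacher = {-1, 1}"
  by (simp add: rademacher_def)

lemma expectation_rademacher: "measure_pmf.expectation rademacher f = (f (-1) + f 1) / 2"
  for f :: "real \<Rightarrow> real"
  by (simp add: rademacher_def integral_pmf_of_set)

lemma map_uminus_rademacher: "map_pmf uminus rademacher = rademacher"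
  unfolding rademacher_def by (subst map_pmf_of_set_inj) (auto simp: insert_commute)

lemma bounded_sum_upto:
  fixes h :: "nat \<Rightarrow> real"
  assumes "\<And>j. j < N \<Longrightarrow> \<bar>h j\<bar> \<le> C"
  shows "\<bar>\<Sum>j<N. h j\<bar> \<le> real N * C"
proof -
  have "\<bar>\<Sum>j<N. h j\<bar> \<le> (\<Sum>j<N. C)"
    by (rule order_trans[OF sum_abs sum_mono]) (simp add: assms)
  then show ?thesis by simp
qed

lemma bdd_above_abs:
  fixes h :: "'i \<Rightarrow> real"
  assumes "\<And>i. i \<in> I \<Longrightarrow> \<bar>h i\<bar> \<le> C"
  shows "bdd_above (h ` I)"
  by (rule bdd_aboveI[of _ C]) (use assms in force)

text \<open>The weights \<open>s\<close> are arbitrary reals, so the supremum is known to be genuine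
  at every sample, whether or not it lies in the support.\<close>

lemma bdd_above_signed_sum:
  fixes g :: "'i \<Rightarrow> 'a \<Rightarrow> real" and s :: "nat \<Rightarrow> real"
  assumes g: "\<And>i a. i \<in> I \<Longrightarrow> \<bar>g i a\<bar> \<le> 1"
  shows "bdd_above ((\<lambda>i. (\<Sum>j<N. s j * g i (z j)) / r) ` I)"
proof -
  have "\<bar>s j * g i (z j)\<bar> \<le> Max (insert 0 ((\<lambda>j. \<bar>s j\<bar>) ` {..<N}))" if "j < N" "i \<in> I" for i j
  proof -
    have "\<bar>s j * g i (z j)\<bar> \<le> \<bar>s j\<bar> * 1"
      unfolding abs_mult using g[OF that(2)] by (intro mult_left_mono) auto
    also have "\<dots> \<le> Max (insert 0 ((\<lambda>j. \<bar>s j\<bar>) ` {..<N}))" using that by (intro Max_ge) auto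
    finally show ?thesis .
  qed
  then have "\<bar>(\<Sum>j<N. s j * g i (z j)) / r\<bar> \<le> real N * Max (insert 0 ((\<lambda>j. \<bar>s j\<bar>) ` {..<N})) / \<bar>r\<bar>"
    if "i \<in> I" for i
    unfolding abs_divide using that by (intro divide_right_mono bounded_sum_upto) auto
  then show ?thesis by (rule bdd_above_abs)
qed

text \<open>The supremum dominates any single member of the class, whose signed sum has mean
  zero.\<close>

lemma rad_class_nonneg:
  fixes g :: "'i \<Rightarrow> 'a \<Rightarrow> real"
  assumes p: "finite (set_pmf p)" and I: "I \<noteq> {}" and g: "\<And>i a. i \<in> I \<Longrightarrow> \<bar>g i a\<bar> \<le> 1"
  shows "0 \<le> rad_class N p I g"
proof -
  obtain i where i: "i \<in> I" using I by blast
  let ?q = "pair_pmf p rademacher"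
  have q: "finite (set_pmf ?q)" using p by (simp add: set_pmf_rademacher)
  have "measure_pmf.expectation ?q (\<lambda>z. snd z * g i (fst z)) = 0"
    using p by (simp add: expectation_pair_pmf set_pmf_rademacher expectation_rademacher)
  then have "0 = measure_pmf.expectation (sample_pmf N ?q) (\<lambda>S. \<Sum>j<N. snd (S j) * g i (fst (S j))) / sqrt (real N)"
    by (subst expectation_sample_sum[OF q, of _ "\<lambda>z. snd z * g i (fst z)"]) simp
  also have "\<dots> = measure_pmf.expectation (sample_pmf N ?q) (\<lambda>S. (\<Sum>j<N. snd (S j) * g i (fst (S j))) / sqrt (real N))"
    by simp
  also have "\<dots> \<le> rad_class N p I g"
    unfolding rad_class_def
    by (intro expectation_mono_finite finite_set_sample_pmf q cSUP_upper i bdd_above_signed_sum g)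
  finally show ?thesis .
qed

theorem symmetrization:
  fixes g :: "'i \<Rightarrow> 'a \<Rightarrow> real"
  assumes p: "finite (set_pmf p)" and N: "N > 0" and I: "I \<noteq> {}" and g: "\<And>i a. i \<in> I \<Longrightarrow> \<bar>g i a\<bar> \<le> 1"
  shows "measure_pmf.expectation (sample_pmf N p)
      (\<lambda>D. SUP i\<in>I. measure_pmf.expectation p (g i) - (\<Sum>j<N. g i (D j)) / real N)
    \<le> 2 * rad_class N p I g / sqrt (real N)"
proof -
  let ?S = "sample_pmf N p" and ?pp = "pair_pmf p p" and ?r = "rademacher"
  have finS: "finite (set_pmf ?S)" using p by (rule finite_set_sample_pmf)
  have finr: "finite (set_pmf ?r)" by (simp add: set_pmf_rademacher)
  have intS: "integrable ?S h" for h :: "_ \<Rightarrow> real" using finS by (rule integrable_measure_pmf_finite)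
  define \<Psi> where "\<Psi> s z = (SUP i\<in>I. (\<Sum>j<N. s j * g i (z j)) / sqrt (real N))" for s :: "nat \<Rightarrow> real" and z
  define \<Phi> where "\<Phi> T = (SUP i\<in>I. (\<Sum>j<N. g i (fst (T j)) - g i (snd (T j))) / real N)" for T
  have bddPhi: "bdd_above ((\<lambda>i. (\<Sum>j<N. g i (fst (T j)) - g i (snd (T j))) / real N) ` I)" for T
  proof (rule bdd_above_abs)
    fix i assume i: "i \<in> I"
    have "\<bar>g i (fst (T j)) - g i (snd (T j))\<bar> \<le> 2" for j
      using g[OF i, of "fst (T j)"] g[OF i, of "snd (T j)"] by linarith
    then show "\<bar>(\<Sum>j<N. g i (fst (T j)) - g i (snd (T j))) / real N\<bar> \<le> real N * 2 / \<bar>real N\<bar>"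
      unfolding abs_divide by (intro divide_right_mono bounded_sum_upto) auto
  qed
  \<comment> \<open>Ghost sample: the true expectation is an average over an independent copy
    \<open>D'\<close>, and the supremum of an average is at most the average of the suprema.\<close>
  have "measure_pmf.expectation ?S (\<lambda>D. SUP i\<in>I. measure_pmf.expectation p (g i) - (\<Sum>j<N. g i (D j)) / real N)
    \<le> measure_pmf.expectation ?S (\<lambda>D. measure_pmf.expectation ?S (\<lambda>D'. \<Phi> (\<lambda>j. if j < N then (D' j, D j) else undefined)))"
  proof (intro expectation_mono_finite finS cSUP_least I)
    fix D :: "nat \<Rightarrow> 'a" and i assume i: "i \<in> I"
    have "measure_pmf.expectation p (g i) - (\<Sum>j<N. g i (D j)) / real N
        = measure_pmf.expectation ?S (\<lambda>D'. (\<Sum>j<N. g i (D' j)) / real N - (\<Sum>j<N. g i (D j)) / real N)"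
      using N by (simp add: intS expectation_sample_sum[OF p] del: Bochner_Integration.integral_sum)
    also have "\<dots> \<le> measure_pmf.expectation ?S (\<lambda>D'. \<Phi> (\<lambda>j. if j < N then (D' j, D j) else undefined))"
    proof (intro expectation_mono_finite finS)
      fix D' :: "nat \<Rightarrow> 'a"
      let ?T = "\<lambda>j. if j < N then (D' j, D j) else undefined"
      have "(\<Sum>j<N. g i (fst (?T j)) - g i (snd (?T j))) / real N \<le> \<Phi> ?T"
        unfolding \<Phi>_def by (rule cSUP_upper[OF i bddPhi])
      then show "(\<Sum>j<N. g i (D' j)) / real N - (\<Sum>j<N. g i (D j)) / real N \<le> \<Phi> ?T"
        by (simp add: sum_subtractf diff_divide_distrib cong: sum.cong_simp)
    qed
    finally show "measure_pmf.expectation p (g i) - (\<Sum>j<N. g i (D j)) / real N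
      \<le> measure_pmf.expectation ?S (\<lambda>D'. \<Phi> (\<lambda>j. if j < N then (D' j, D j) else undefined))" .
  qed
  also have "\<dots> = measure_pmf.expectation (sample_pmf N ?pp) \<Phi>"
    unfolding expectation_sample_pair[OF p p] by (rule expectation_swap[OF finS finS])
  also have "\<dots> \<le> 2 * rad_class N p I g / sqrt (real N)"
  proof -
    let ?q = "pair_pmf ?pp ?r"
    have q: "finite (set_pmf ?q)" using p finr by simp
    have intq: "integrable (sample_pmf N ?q) h" for h :: "_ \<Rightarrow> real"
      using q by (intro integrable_measure_pmf_finite finite_set_sample_pmf)
    \<comment> \<open>A fair sign that decides whether to exchange the two copies leaves their joint law unchanged.\<close>
    define h where "h z = (if snd z = 1 then fst z else prod.swap (fst z))" for z :: "('a \<times> 'a) \<times> real"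
    have swap_eq: "(prod.swap :: 'a \<times> 'a \<Rightarrow> _) = (\<lambda>(x, y). (y, x))" by auto
    have swap: "map_pmf prod.swap ?pp = ?pp"
      unfolding swap_eq by (rule pair_commute_pmf[symmetric])
    have "map_pmf h ?q = bind_pmf ?r (\<lambda>s. map_pmf (\<lambda>x. h (x, s)) ?pp)"
      by (subst pair_commute_pmf) (simp add: pair_pmf_def map_pmf_def bind_assoc_pmf bind_return_pmf)
    also have "\<dots> = bind_pmf ?r (\<lambda>s. ?pp)"
      by (intro bind_pmf_cong refl) (auto simp: h_def swap set_pmf_rademacher)
    finally have hq: "map_pmf h ?q = ?pp" by simp
    \<comment> \<open>Each copy together with the sign is distributed like one signed sample; for
      the second copy this uses the symmetry of the sign.\<close>
    have m1: "map_pmf (\<lambda>z. (fst (fst z), snd z)) ?q = pair_pmf p ?r"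
      using map_pair[of fst "\<lambda>x. x" ?pp ?r] by (simp add: case_prod_unfold map_fst_pair_pmf)
    have m2: "map_pmf (\<lambda>z. (snd (fst z), - snd z)) ?q = pair_pmf p ?r"
      using map_pair[of snd uminus ?pp ?r] by (simp add: case_prod_unfold map_snd_pair_pmf map_uminus_rademacher)
    have "measure_pmf.expectation (sample_pmf N ?pp) \<Phi>
      = measure_pmf.expectation (sample_pmf N ?q) (\<lambda>T. \<Phi> (\<lambda>j. if j < N then h (T j) else undefined))"
      using expectation_sample_map[OF q, of N h \<Phi>] by (simp add: hq)
    also have "\<dots> \<le> measure_pmf.expectation (sample_pmf N ?q) (\<lambda>T. \<Psi> (\<lambda>j. snd (T j)) (\<lambda>j. fst (fst (T j))) / sqrt (real N)
        + \<Psi> (\<lambda>j. - snd (T j)) (\<lambda>j. snd (fst (T j))) / sqrt (real N))"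
    proof (intro expectation_mono_finite finite_set_sample_pmf q)
      fix T assume T: "T \<in> set_pmf (sample_pmf N ?q)"
      have "(\<Sum>j<N. g i (fst (h (T j))) - g i (snd (h (T j)))) / real N
          \<le> \<Psi> (\<lambda>j. snd (T j)) (\<lambda>j. fst (fst (T j))) / sqrt (real N)
          + \<Psi> (\<lambda>j. - snd (T j)) (\<lambda>j. snd (fst (T j))) / sqrt (real N)" if i: "i \<in> I" for i
      proof -
        \<comment> \<open>Sign \<open>1\<close> keeps the pair and sign \<open>-1\<close> exchanges
          it, so each summand is the sign times the difference of the unexchanged values.\<close>
        have "(\<Sum>j<N. g i (fst (h (T j))) - g i (snd (h (T j))))
            = (\<Sum>j<N. snd (T j) * g i (fst (fst (T j)))) + (\<Sum>j<N. - snd (T j) * g i (snd (fst (T j))))"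
          unfolding sum.distrib[symmetric]
        proof (intro sum.cong refl)
          fix j assume "j \<in> {..<N}"
          then have "snd (T j) \<in> {-1, 1}" using sample_pmf_mem[OF T, of j] by (auto simp: set_pmf_rademacher)
          then show "g i (fst (h (T j))) - g i (snd (h (T j)))
            = snd (T j) * g i (fst (fst (T j))) + - snd (T j) * g i (snd (fst (T j)))"
            by (auto simp: h_def)
        qed
        moreover have "(\<Sum>j<N. snd (T j) * g i (fst (fst (T j)))) / sqrt (real N)
            \<le> \<Psi> (\<lambda>j. snd (T j)) (\<lambda>j. fst (fst (T j)))"
          unfolding \<Psi>_def by (intro cSUP_upper i bdd_above_signed_sum g)
        moreover have "(\<Sum>j<N. - snd (T j) * g i (snd (fst (T j)))) / sqrt (real N)
            \<le> \<Psi> (\<lambda>j. - snd (T j)) (\<lambda>j. snd (fst (T j)))"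
          unfolding \<Psi>_def by (intro cSUP_upper i bdd_above_signed_sum g)
        ultimately have "(\<Sum>j<N. g i (fst (h (T j))) - g i (snd (h (T j)))) / sqrt (real N)
            \<le> \<Psi> (\<lambda>j. snd (T j)) (\<lambda>j. fst (fst (T j))) + \<Psi> (\<lambda>j. - snd (T j)) (\<lambda>j. snd (fst (T j)))"
          by (simp only: add_divide_distrib)
        \<comment> \<open>The factor \<open>1 / real N\<close> is split into two inverse roots: one
          is the normalization inside \<open>\<Psi>\<close>, the other stays in the final
          bound.\<close>
        then have "(\<Sum>j<N. g i (fst (h (T j))) - g i (snd (h (T j)))) / sqrt (real N) / sqrt (real N)
            \<le> (\<Psi> (\<lambda>j. snd (T j)) (\<lambda>j. fst (fst (T j))) + \<Psi> (\<lambda>j. - snd (T j)) (\<lambda>j. snd (fst (T j)))) / sqrt (real N)"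
          by (rule divide_right_mono) simp
        then show ?thesis by (simp add: add_divide_distrib)
      qed
      then show "\<Phi> (\<lambda>j. if j < N then h (T j) else undefined) \<le> \<Psi> (\<lambda>j. snd (T j)) (\<lambda>j. fst (fst (T j))) / sqrt (real N)
          + \<Psi> (\<lambda>j. - snd (T j)) (\<lambda>j. snd (fst (T j))) / sqrt (real N)"
        unfolding \<Phi>_def by (intro cSUP_least I) (simp cong: sum.cong_simp)
    qed
    also have "\<dots> = measure_pmf.expectation (sample_pmf N ?q) (\<lambda>T. \<Psi> (\<lambda>j. snd (T j)) (\<lambda>j. fst (fst (T j)))) / sqrt (real N)
        + measure_pmf.expectation (sample_pmf N ?q) (\<lambda>T. \<Psi> (\<lambda>j. - snd (T j)) (\<lambda>j. snd (fst (T j)))) / sqrt (real N)"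
      by (simp add: intq)
    also have "measure_pmf.expectation (sample_pmf N ?q) (\<lambda>T. \<Psi> (\<lambda>j. snd (T j)) (\<lambda>j. fst (fst (T j)))) = rad_class N p I g"
      unfolding rad_class_def m1[symmetric] expectation_sample_map[OF q] \<Psi>_def
      by (simp cong: sum.cong_simp)
    also have "measure_pmf.expectation (sample_pmf N ?q) (\<lambda>T. \<Psi> (\<lambda>j. - snd (T j)) (\<lambda>j. snd (fst (T j)))) = rad_class N p I g"
      unfolding rad_class_def m2[symmetric] expectation_sample_map[OF q] \<Psi>_def
      by (simp cong: sum.cong_simp)
    finally show ?thesis by simp
  qed
  finally show ?thesis .
qed

section \<open>Measurements and the Renyi bound\<close>

lemma ctrace_add: "ctrace (A + B) = ctrace A + ctrace B"
  by (simp add: ctrace_def sum.distrib)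

lemma povm_exists: "{M :: bool \<Rightarrow> complex^'n^'n. povm M} \<noteq> {}"
proof -
  have "psd (mat 1 :: complex^'n^'n)" "psd (0 :: complex^'n^'n)"
    by (auto simp: psd_iff selfadj_def linear_matrix_complex)
  then have "povm (\<lambda>c. if c then mat 1 else 0 :: complex^'n^'n)" by (simp add: povm_def)
  then show ?thesis by blast
qed

lemma povm_psd: "povm M \<Longrightarrow> psd (M c)"
  by (cases c) (auto simp: povm_def)

lemma povm_add: "povm M \<Longrightarrow> M c + M (\<not> c) = mat 1"
  by (cases c) (auto simp: povm_def add.commute)

lemma povm_trace:
  assumes "density_matrix A" "povm M"
  shows "Re (ctrace (M c ** A)) + Re (ctrace (M (\<not> c) ** A)) = 1"
proof -
  have "M c ** A + M (\<not> c) ** A = (M c + M (\<not> c)) ** A"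
    by (simp add: vec_eq_iff matrix_matrix_mult_def sum.distrib algebra_simps)
  then have "M c ** A + M (\<not> c) ** A = A"
    by (simp add: povm_add[OF assms(2)])
  then have "ctrace (M c ** A) + ctrace (M (\<not> c) ** A) = 1"
    using assms(1) by (simp add: density_matrix_def flip: ctrace_add)
  then show ?thesis by (metis one_complex.simps(1) plus_complex.simps(1))
qed

text \<open>Outcome probabilities are traces of products of positive matrices; the lower bound comes
  from the probability of the complementary outcome.\<close>

lemma loss_bounds:
  assumes "\<And>\<theta> x. density_matrix (rho \<theta> x)" "povm M"
  shows "0 \<le> loss rho \<theta> M z" "loss rho \<theta> M z \<le> 1"
proof -
  have 1: "0 \<le> Re (ctrace (M c ** rho \<theta> x))" for c x
    using assms(1) by (intro trace_mult_nonneg povm_psd[OF assms(2)]) (simp add: density_matrix_def)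
  show "0 \<le> loss rho \<theta> M z"
    using povm_trace[OF assms(1) assms(2), of "fst z" \<theta> "snd z"] 1[of "\<not> fst z" "snd z"] by (simp add: loss_def)
  show "loss rho \<theta> M z \<le> 1"
    using 1[of "fst z" "snd z"] by (simp add: loss_def)
qed

text \<open>The two effects sum to the identity and hence commute. This makes the inner product of
  their values at \<open>v\<close> nonnegative, and polarization gives the squared norm of the
  difference as that of \<open>v\<close> minus four times this product.\<close>

lemma povm_difference_contraction:
  assumes "povm M"
  shows "norm (M True *v v - M False *v v) \<le> norm v"
proof -
  let ?P = "\<lambda>v. M True *v v" and ?Q = "\<lambda>v. M False *v v"
  have sum: "?P v + ?Q v = v" for v
    using povm_add[OF assms, of True] matrix_vector_mult_add_rdistrib[of "M True" "M False" v] by simp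
  have saP: "?P x \<bullet> y = x \<bullet> ?P y" and saQ: "?Q x \<bullet> y = x \<bullet> ?Q y" for x y
    using povm_psd[OF assms] by (auto simp: psd_iff selfadj_def)
  have Qeq: "?Q v = v - ?P v" for v using sum[of v] by (simp add: algebra_simps)
  have comm: "?Q (?P v) = ?P (?Q v)"
    unfolding Qeq by (simp add: linear_diff[OF linear_matrix_complex])
  have "?P v \<bullet> ?Q v = ?P v \<bullet> ?Q (?P v + ?Q v)" by (simp only: sum)
  also have "\<dots> = ?P v \<bullet> ?Q (?P v) + ?Q (?P v) \<bullet> ?Q v"
    by (simp only: linear_add[OF linear_matrix_complex] inner_add_right saQ)
  also have "\<dots> = ?P v \<bullet> ?Q (?P v) + ?Q v \<bullet> ?P (?Q v)" by (simp only: comm inner_commute)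
  also have "\<dots> \<ge> 0" using povm_psd[OF assms] by (intro add_nonneg_nonneg) (auto simp: psd_iff)
  finally have pos: "0 \<le> ?P v \<bullet> ?Q v" .
  have "(norm (?P v - ?Q v))\<^sup>2 = (norm (?P v + ?Q v))\<^sup>2 - 4 * (?P v \<bullet> ?Q v)"
    by (simp add: power2_norm_eq_inner inner_add inner_diff inner_commute)
  then have "(norm (?P v - ?Q v))\<^sup>2 \<le> (norm v)\<^sup>2" using pos by (simp add: sum)
  then show ?thesis by (rule power2_le_imp_le) simp
qed

lemma povm_difference_trace:
  assumes M: "povm M" and onb: "onb E"
  shows "Re (ctrace (M True ** A)) - Re (ctrace (M False ** A))
    = (\<Sum>e\<in>E. (M True *v e - M False *v e) \<bullet> (A *v e)) / 2"
proof -
  have *: "2 * Re (ctrace (M c ** A)) = (\<Sum>e\<in>E. (M c *v e) \<bullet> (A *v e))" for c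
  proof -
    have "2 * Re (ctrace (M c ** A)) = (\<Sum>e\<in>E. e \<bullet> ((M c ** A) *v e))"
      using rtrace_matrix[of "M c ** A"] rtrace_onb[OF onb linear_matrix_complex] by metis
    also have "\<dots> = (\<Sum>e\<in>E. (M c *v e) \<bullet> (A *v e))"
      using povm_psd[OF M, of c] by (simp add: psd_iff selfadj_def flip: matrix_vector_mul_assoc)
    finally show ?thesis .
  qed
  show ?thesis
    using *[of True] *[of False] by (simp add: inner_diff_left sum_subtractf)
qed

text \<open>Complementary outcome probabilities sum to 1, so each is half of 1 plus or minus their
  difference; the real basis halves the sum again, whence 1/4. The basis is left free so that it can
  later be adapted to the states.\<close>

lemma loss_eq:
  assumes "\<And>\<theta> x. density_matrix (rho \<theta> x)" and M: "povm M" and onb: "onb E"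
  shows "loss rho \<theta> M z = 1/2 - (if fst z then 1 else -1) / 4 *
    (\<Sum>e\<in>E. (M True *v e - M False *v e) \<bullet> (rho \<theta> (snd z) *v e))"
  using povm_trace[OF assms(1) M, of "fst z" \<theta> "snd z"] povm_difference_trace[OF M onb, of "rho \<theta> (snd z)"]
  by (cases "fst z") (simp_all add: loss_def)

section \<open>The mean-square matrix and the trace of its root\<close>

lemma matrix_vector_mult_sum_scaleR:
  fixes B :: "'x::finite \<Rightarrow> complex^'n^'n"
  shows "(\<Sum>x\<in>UNIV. c x *\<^sub>R B x) *v v = (\<Sum>x\<in>UNIV. c x *\<^sub>R (B x *v v))"
proof -
  have "linear (\<lambda>A :: complex^'n^'n. A *v v)"
    by (rule linearI) (simp_all add: vec_eq_iff matrix_vector_mult_def scaleR_sum_right sum.distrib algebra_simps)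
  note lin = this
  show ?thesis by (subst linear_sum[OF lin]) (simp add: linear_scale[OF lin])
qed

text \<open>At \<open>r = rho \<theta>\<close> this is the matrix whose root is taken in
  \<open>renyi2_MI\<close>.\<close>

definition mean_square :: "(bool \<times> 'x::finite) pmf \<Rightarrow> ('x \<Rightarrow> complex^'n^'n) \<Rightarrow> complex^'n^'n" where
  "mean_square p r = (\<Sum>x\<in>UNIV. pmf (map_pmf snd p) x *\<^sub>R (r x ** r x))"

lemma mean_square_psd:
  fixes r :: "'x::finite \<Rightarrow> complex^'n^'n"
  assumes "\<And>x. density_matrix (r x)"
  shows "psd (mean_square p r)"
    and "v \<bullet> (mean_square p r *v v) = measure_pmf.expectation p (\<lambda>z. (norm (r (snd z) *v v))\<^sup>2)"
proof -
  have sa: "(r x *v v) \<bullet> w = v \<bullet> (r x *v w)" for x v w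
    using assms[of x] by (simp add: density_matrix_def psd_iff selfadj_def)
  have mv: "mean_square p r *v v = (\<Sum>x\<in>UNIV. pmf (map_pmf snd p) x *\<^sub>R (r x *v (r x *v v)))" for v
    by (simp add: mean_square_def matrix_vector_mult_sum_scaleR matrix_vector_mul_assoc)
  have eq: "v \<bullet> (mean_square p r *v v) = (\<Sum>x\<in>UNIV. pmf (map_pmf snd p) x * (norm (r x *v v))\<^sup>2)" for v
    by (simp add: mv inner_sum_right power2_norm_eq_inner sa)
  show "psd (mean_square p r)"
    unfolding psd_iff selfadj_def
  proof (intro conjI allI linear_matrix_complex)
    fix v w show "(mean_square p r *v v) \<bullet> w = v \<bullet> (mean_square p r *v w)"
      by (simp add: mv inner_sum_left inner_sum_right sa)
    show "0 \<le> v \<bullet> (mean_square p r *v v)" unfolding eq by (intro sum_nonneg) simp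
  qed
  have "measure_pmf.expectation p (\<lambda>z. (norm (r (snd z) *v v))\<^sup>2)
      = measure_pmf.expectation (map_pmf snd p) (\<lambda>x. (norm (r x *v v))\<^sup>2)" by simp
  also have "\<dots> = v \<bullet> (mean_square p r *v v)"
    unfolding eq by (subst integral_measure_pmf_real[where A = UNIV]) (auto simp: mult.commute)
  finally show "v \<bullet> (mean_square p r *v v) = measure_pmf.expectation p (\<lambda>z. (norm (r (snd z) *v v))\<^sup>2)" by simp
qed

text \<open>For a unit eigenvector \<open>e\<close>, the eigenvalue is the value of the quadratic
  form, which is the second moment of \<open>norm (r x *v e)\<close>. The trace of the root is thus
  half a sum of root mean squares.\<close>

lemma trace_sqrt_mean_square:
  fixes r :: "'x::finite \<Rightarrow> complex^'n^'n"
  assumes dens: "\<And>x. density_matrix (r x)"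
  obtains E where "onb E"
    "Re (ctrace (msqrt (mean_square p r))) = (\<Sum>e\<in>E. sqrt (measure_pmf.expectation p (\<lambda>z. (norm (r (snd z) *v e))\<^sup>2))) / 2"
proof -
  let ?A = "mean_square p r"
  have psd: "psd ?A" using dens by (rule mean_square_psd)
  obtain E l where El: "onb E" "\<And>e. e \<in> E \<Longrightarrow> ?A *v e = l e *\<^sub>R e" "\<And>e. e \<in> E \<Longrightarrow> l e \<ge> 0"
    using psd_eigenbasis[OF psd] by blast
  have "l e = measure_pmf.expectation p (\<lambda>z. (norm (r (snd z) *v e))\<^sup>2)" if e: "e \<in> E" for e
    using mean_square_psd(2)[where r = r and p = p and v = e, OF dens] El(2)[OF e] onb_inner[OF El(1) e e] by simp
  then have "(\<Sum>e\<in>E. sqrt (l e)) = (\<Sum>e\<in>E. sqrt (measure_pmf.expectation p (\<lambda>z. (norm (r (snd z) *v e))\<^sup>2)))"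
    by (intro sum.cong) auto
  then show ?thesis using that[OF El(1)] ctrace_msqrt[OF psd El] by simp
qed

text \<open>The upper bound depends on the dimension alone and so is uniform in the parameter, which
  later makes the supremum in the Renyi bound genuine.\<close>

lemma trace_sqrt_mean_square_bounds:
  fixes r :: "'x::finite \<Rightarrow> complex^'n^'n"
  assumes dens: "\<And>x. density_matrix (r x)"
  shows "0 \<le> Re (ctrace (msqrt (mean_square p r)))"
    and "Re (ctrace (msqrt (mean_square p r))) \<le> DIM(complex^'n)"
proof -
  obtain E :: "(complex^'n) set" where onb: "onb E" and
    eq: "Re (ctrace (msqrt (mean_square p r))) = (\<Sum>e\<in>E. sqrt (measure_pmf.expectation p (\<lambda>z. (norm (r (snd z) *v e))\<^sup>2))) / 2"
    using trace_sqrt_mean_square[where r = r, OF dens] by blast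
  show "0 \<le> Re (ctrace (msqrt (mean_square p r)))"
    unfolding eq by (intro divide_nonneg_pos sum_nonneg) auto
  have "sqrt (measure_pmf.expectation p (\<lambda>z. (norm (r (snd z) *v e))\<^sup>2)) \<le> 2" if e: "e \<in> E" for e
  proof -
    have "norm (r x *v e) \<le> 2" for x
      using norm_density_mult_le[OF dens[of x], of e] onb e by (simp add: onb_def)
    then have "(norm (r x *v e))\<^sup>2 \<le> 2\<^sup>2" for x by (intro power_mono) auto
    then have "measure_pmf.expectation p (\<lambda>z. (norm (r (snd z) *v e))\<^sup>2) \<le> measure_pmf.expectation p (\<lambda>_. 2\<^sup>2)"
      by (intro expectation_mono_finite) auto
    then show ?thesis by (intro real_le_lsqrt) auto
  qed
  then have "(\<Sum>e\<in>E. sqrt (measure_pmf.expectation p (\<lambda>z. (norm (r (snd z) *v e))\<^sup>2))) \<le> (\<Sum>e\<in>E. 2)"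
    by (rule sum_mono)
  moreover have "real (card E) = real DIM(complex^'n)"
  proof -
    have "real (card E) = (\<Sum>e\<in>E. e \<bullet> e)" by (simp add: onb_inner[OF onb] cong: sum.cong_simp)
    also have "\<dots> = rtrace (\<lambda>x :: complex^'n. x)" using rtrace_onb[OF onb linear_ident] by simp
    also have "\<dots> = real DIM(complex^'n)" by (simp add: rtrace_def)
    finally show ?thesis .
  qed
  ultimately show "Re (ctrace (msqrt (mean_square p r))) \<le> DIM(complex^'n)"
    unfolding eq by simp
qed

lemma rad_class_povm_le:
  fixes p :: "(bool \<times> 'x::finite) pmf" and rho :: "'t \<Rightarrow> 'x \<Rightarrow> complex^'n^'n"
  assumes dens: "\<And>\<theta> x. density_matrix (rho \<theta> x)" and N: "N > 0"
  shows "rad_class N p {M. povm M} (loss rho \<theta>) \<le> 1/2 * Re (ctrace (msqrt (mean_square p (rho \<theta>))))"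
proof -
  obtain E :: "(complex^'n) set" where onb: "onb E" and
    eq: "Re (ctrace (msqrt (mean_square p (rho \<theta>)))) = (\<Sum>e\<in>E. sqrt (measure_pmf.expectation p (\<lambda>z. (norm (rho \<theta> (snd z) *v e))\<^sup>2))) / 2"
    using trace_sqrt_mean_square[where r = "rho \<theta>", OF dens] by blast
  let ?q = "pair_pmf p rademacher" and ?R = "sqrt (real N)"
  have fp: "finite (set_pmf p)" by simp
  have fr: "finite (set_pmf rademacher)" by (simp add: set_pmf_rademacher)
  have q: "finite (set_pmf ?q)" using fp fr by simp
  have fS: "finite (set_pmf (sample_pmf N ?q))" using q by (rule finite_set_sample_pmf)
  have intS: "integrable (sample_pmf N ?q) h" for h :: "_ \<Rightarrow> real"
    using fS by (rule integrable_measure_pmf_finite)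
  define X where "X e y = (snd y * (if fst (fst y) then 1 else -1)) *\<^sub>R (rho \<theta> (snd (fst y)) *v e)" for e and y :: "(bool \<times> 'x) \<times> real"
  have "rad_class N p {M. povm M} (loss rho \<theta>)
    \<le> measure_pmf.expectation (sample_pmf N ?q) (\<lambda>S. (\<Sum>j<N. snd (S j)) / (2 * ?R) + (\<Sum>e\<in>E. norm (\<Sum>j<N. X e (S j))) / (4 * ?R))"
    unfolding rad_class_def
  proof (intro expectation_mono_finite fS cSUP_least povm_exists)
    fix S :: "nat \<Rightarrow> (bool \<times> 'x) \<times> real" and M :: "bool \<Rightarrow> complex^'n^'n" assume "M \<in> {M. povm M}"
    then have M: "povm M" by simp
    let ?K = "\<lambda>e. M True *v e - M False *v e"
    have sumX: "(\<Sum>e\<in>E. ?K e \<bullet> X e y) = snd y * (if fst (fst y) then 1 else -1)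
        * (\<Sum>e\<in>E. ?K e \<bullet> (rho \<theta> (snd (fst y)) *v e))" for y
      unfolding X_def inner_scaleR_right sum_distrib_left ..
    have arith: "a * (1/2 - s / 4 * k) = a / 2 - (a * s * k) / 4" for a s k :: real
      by (simp add: field_simps)
    \<comment> \<open>The constant part of the loss leaves a sum of signs that is independent of
      \<open>M\<close> and will average to zero; only the \<open>X\<close> part depends on the
      measurement.\<close>
    have "snd (S j) * loss rho \<theta> M (fst (S j)) = snd (S j) / 2 - (\<Sum>e\<in>E. ?K e \<bullet> X e (S j)) / 4" for j
      unfolding loss_eq[where rho = rho, OF dens M onb] sumX arith ..
    then have "(\<Sum>j<N. snd (S j) * loss rho \<theta> M (fst (S j))) = (\<Sum>j<N. snd (S j)) / 2 - (\<Sum>j<N. \<Sum>e\<in>E. ?K e \<bullet> X e (S j)) / 4"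
      by (simp add: sum_subtractf sum_divide_distrib)
    also have "(\<Sum>j<N. \<Sum>e\<in>E. ?K e \<bullet> X e (S j)) = (\<Sum>e\<in>E. ?K e \<bullet> (\<Sum>j<N. X e (S j)))"
      unfolding inner_sum_right by (rule sum.swap)
    finally have eqS: "(\<Sum>j<N. snd (S j) * loss rho \<theta> M (fst (S j)))
      = (\<Sum>j<N. snd (S j)) / 2 - (\<Sum>e\<in>E. ?K e \<bullet> (\<Sum>j<N. X e (S j))) / 4" .
    have "- (\<Sum>e\<in>E. ?K e \<bullet> (\<Sum>j<N. X e (S j))) \<le> (\<Sum>e\<in>E. norm (\<Sum>j<N. X e (S j)))"
      unfolding sum_negf[symmetric]
    proof (rule sum_mono)
      fix e assume "e \<in> E"
      then have "norm (?K e) \<le> 1" using povm_difference_contraction[OF M, of e] onb by (simp add: onb_def)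
      then have "norm (?K e) * norm (\<Sum>j<N. X e (S j)) \<le> 1 * norm (\<Sum>j<N. X e (S j))"
        by (intro mult_right_mono) auto
      then show "- (?K e \<bullet> (\<Sum>j<N. X e (S j))) \<le> norm (\<Sum>j<N. X e (S j))"
        using Cauchy_Schwarz_ineq2[of "?K e" "\<Sum>j<N. X e (S j)"] by linarith
    qed
    then have "(\<Sum>j<N. snd (S j) * loss rho \<theta> M (fst (S j))) \<le> (\<Sum>j<N. snd (S j)) / 2 + (\<Sum>e\<in>E. norm (\<Sum>j<N. X e (S j))) / 4"
      unfolding eqS by linarith
    from divide_right_mono[OF this, of ?R]
    show "(\<Sum>j<N. snd (S j) * loss rho \<theta> M (fst (S j))) / ?R
      \<le> (\<Sum>j<N. snd (S j)) / (2 * ?R) + (\<Sum>e\<in>E. norm (\<Sum>j<N. X e (S j))) / (4 * ?R)"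
      by (simp add: add_divide_distrib)
  qed
  also have "\<dots> = measure_pmf.expectation (sample_pmf N ?q) (\<lambda>S. \<Sum>j<N. snd (S j)) / (2 * ?R)
      + (\<Sum>e\<in>E. measure_pmf.expectation (sample_pmf N ?q) (\<lambda>S. norm (\<Sum>j<N. X e (S j)))) / (4 * ?R)"
    by (simp add: intS)
  also have "measure_pmf.expectation (sample_pmf N ?q) (\<lambda>S. \<Sum>j<N. snd (S j)) = 0"
    using expectation_sample_sum[OF q, of N snd] expectation_rademacher[of "\<lambda>x. x"]
      expectation_pair_pmf_snd[of p rademacher "\<lambda>x. x"] by simp
  \<comment> \<open>First moments are bounded by root second moments, and these add over the centred
    independent draws; the resulting \<open>?R\<close> cancels the normalization.\<close>
  also have "(\<Sum>e\<in>E. measure_pmf.expectation (sample_pmf N ?q) (\<lambda>S. norm (\<Sum>j<N. X e (S j))))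
     \<le> (\<Sum>e\<in>E. ?R * sqrt (measure_pmf.expectation p (\<lambda>z. (norm (rho \<theta> (snd z) *v e))\<^sup>2)))"
  proof (rule sum_mono)
    fix e assume "e \<in> E"
    have zero: "measure_pmf.expectation ?q (\<lambda>y. X e y \<bullet> t) = 0" for t
      by (simp add: expectation_pair_pmf[OF fp fr] X_def expectation_rademacher)
    have "\<bar>if b then 1 else - 1 :: real\<bar> = 1" for b by simp
    then have sq: "measure_pmf.expectation ?q (\<lambda>y. (norm (X e y))\<^sup>2) = measure_pmf.expectation p (\<lambda>z. (norm (rho \<theta> (snd z) *v e))\<^sup>2)"
      by (simp add: expectation_pair_pmf[OF fp fr] X_def expectation_rademacher)
    have "measure_pmf.expectation (sample_pmf N ?q) (\<lambda>S. norm (\<Sum>j<N. X e (S j)))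
      \<le> sqrt (measure_pmf.expectation (sample_pmf N ?q) (\<lambda>S. (norm (\<Sum>j<N. X e (S j)))\<^sup>2))"
      by (rule expectation_le_sqrt[OF fS])
    also have "\<dots> = sqrt (real N * measure_pmf.expectation p (\<lambda>z. (norm (rho \<theta> (snd z) *v e))\<^sup>2))"
      using expectation_norm_sum_sq[OF q zero, of N] by (simp add: sq)
    finally show "measure_pmf.expectation (sample_pmf N ?q) (\<lambda>S. norm (\<Sum>j<N. X e (S j)))
      \<le> ?R * sqrt (measure_pmf.expectation p (\<lambda>z. (norm (rho \<theta> (snd z) *v e))\<^sup>2))"
      by (simp add: real_sqrt_mult)
  qed
  \<comment> \<open>The coefficient 1/4 becomes 1/2 because \<open>eq\<close> expresses the complex
    trace as half of the sum over the real basis.\<close>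
  finally show ?thesis
    unfolding eq using N by (simp add: divide_right_mono sum_distrib_left[symmetric])
qed

section \<open>The two complexities and the Renyi bound\<close>

lemma rad_M_eq: "rad_M N p rho = (SUP \<theta>. rad_class N p {M. povm M} (loss rho \<theta>))"
  by (simp add: rad_M_def rad_class_def)

lemma rad_TM_eq:
  "rad_TM N p rho = rad_class N p (UNIV \<times> {M. povm M}) (\<lambda>\<theta>M. loss rho (fst \<theta>M) (snd \<theta>M))"
  by (simp add: rad_TM_def rad_class_def)

text \<open>At \<open>t = 0\<close> the logarithm takes the default value 0 and the power is 1.
  Hence the first claim is an inequality and the second has a maximum with 1.\<close>

lemma powr_two_log_bounds:
  fixes t :: real
  assumes "0 \<le> t" "t \<le> C"
  shows "t\<^sup>2 \<le> 2 powr (2 * log 2 t)" "2 powr (2 * log 2 t) \<le> max 1 (C\<^sup>2)"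
proof -
  have "2 powr (2 * log 2 t) = (if t = 0 then 1 else t\<^sup>2)"
  proof (cases "t = 0")
    case False
    then have "2 powr (2 * log 2 t) = 2 powr log 2 (t\<^sup>2)" using assms by (simp add: log_nat_power)
    then show ?thesis using False by simp
  qed (simp add: log_def)
  moreover have "t\<^sup>2 \<le> C\<^sup>2" using assms by (intro power_mono)
  ultimately show "t\<^sup>2 \<le> 2 powr (2 * log 2 t)" "2 powr (2 * log 2 t) \<le> max 1 (C\<^sup>2)"
    by auto
qed

lemma rad_class_le_renyi:
  fixes p :: "(bool \<times> 'x::finite) pmf" and rho :: "'t \<Rightarrow> 'x \<Rightarrow> complex^'n^'n"
  assumes dens: "\<And>\<theta> x. density_matrix (rho \<theta> x)" and N: "N > 0"
  shows "rad_class N p {M. povm M} (loss rho \<theta>) \<le> 1/2 * sqrt (SUP \<theta>. 2 powr renyi2_MI p rho \<theta>)"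
proof -
  let ?t = "\<lambda>\<theta>. Re (ctrace (msqrt (mean_square p (rho \<theta>))))"
  have I: "renyi2_MI p rho \<theta> = 2 * log 2 (?t \<theta>)" for \<theta>
    by (simp add: renyi2_MI_def mean_square_def)
  have bounds: "(?t \<theta>)\<^sup>2 \<le> 2 powr (2 * log 2 (?t \<theta>))"
    "2 powr (2 * log 2 (?t \<theta>)) \<le> max 1 ((real DIM(complex^'n))\<^sup>2)" for \<theta>
    using powr_two_log_bounds[OF trace_sqrt_mean_square_bounds[where r = "rho \<theta>", OF dens]] by blast+
  have "bdd_above (range (\<lambda>\<theta>. 2 powr renyi2_MI p rho \<theta>))"
    unfolding I using bounds(2) by (intro bdd_aboveI2)
  then have "2 powr renyi2_MI p rho \<theta> \<le> (SUP \<theta>. 2 powr renyi2_MI p rho \<theta>)"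
    by (rule cSUP_upper2[OF _ UNIV_I order_refl])
  with bounds(1)[of \<theta>] have "(?t \<theta>)\<^sup>2 \<le> (SUP \<theta>. 2 powr renyi2_MI p rho \<theta>)"
    unfolding I by (rule order_trans)
  then have "?t \<theta> \<le> sqrt (SUP \<theta>. 2 powr renyi2_MI p rho \<theta>)" by (rule real_le_rsqrt)
  then show ?thesis using rad_class_povm_le[where rho = rho and p = p and \<theta> = \<theta>, OF dens N] by simp
qed

section \<open>The generalization bound\<close>

lemma average_update_le:
  fixes h :: "'a \<Rightarrow> real"
  assumes "\<And>a. 0 \<le> h a" "\<And>a. h a \<le> 1" and j: "j < N"
  shows "(\<Sum>k<N. h ((D(j := a)) k)) / real N \<le> (\<Sum>k<N. h (D k)) / real N + 1 / real N"
    and "(\<Sum>k<N. h (D k)) / real N \<le> (\<Sum>k<N. h ((D(j := a)) k)) / real N + 1 / real N"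
proof -
  have rem: "(\<Sum>k<N. h (D' k)) = h (D' j) + (\<Sum>k\<in>{..<N}-{j}. h (D' k))" for D'
    using j by (intro sum.remove) auto
  have "(\<Sum>k\<in>{..<N}-{j}. h ((D(j := a)) k)) = (\<Sum>k\<in>{..<N}-{j}. h (D k))"
    by (intro sum.cong) auto
  then have eq: "(\<Sum>k<N. h ((D(j := a)) k)) - h a = (\<Sum>k<N. h (D k)) - h (D j)"
    by (simp only: rem fun_upd_same)
  from eq have "(\<Sum>k<N. h ((D(j := a)) k)) \<le> (\<Sum>k<N. h (D k)) + 1"
    using assms(1)[of "D j"] assms(2)[of a] by linarith
  from divide_right_mono[OF this, of "real N"]
  show "(\<Sum>k<N. h ((D(j := a)) k)) / real N \<le> (\<Sum>k<N. h (D k)) / real N + 1 / real N"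
    by (simp add: add_divide_distrib)
  from eq have "(\<Sum>k<N. h (D k)) \<le> (\<Sum>k<N. h ((D(j := a)) k)) + 1"
    using assms(2)[of "D j"] assms(1)[of a] by linarith
  from divide_right_mono[OF this, of "real N"]
  show "(\<Sum>k<N. h (D k)) / real N \<le> (\<Sum>k<N. h ((D(j := a)) k)) / real N + 1 / real N"
    by (simp add: add_divide_distrib)
qed

text \<open>The reverse inequality is the same assumption at the updated sample, with the update
  undone.\<close>

lemma bounded_differences_one_sided:
  fixes f :: "(nat \<Rightarrow> 'a) \<Rightarrow> real"
  assumes "\<And>D a. f (D(j := a)) \<le> f D + c"
  shows "\<bar>f (D(j := a)) - f D\<bar> \<le> c"
  using assms[of D a] assms[of "D(j := a)" "D j"] by simp

theorem theorem4p2: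
  fixes p :: "(bool \<times> 'x::finite) pmf"
    and rho :: "'t \<Rightarrow> 'x \<Rightarrow> complex^'n^'n"
    and N :: nat and \<delta> :: real
    and thetahat :: "(nat \<Rightarrow> bool \<times> 'x) \<Rightarrow> 't"
    and Mhat :: "'t \<Rightarrow> (nat \<Rightarrow> bool \<times> 'x) \<Rightarrow> bool \<Rightarrow> complex^'n^'n"
  assumes dens: "\<And>\<theta> x. density_matrix (rho \<theta> x)"
    and N_pos: "N > 0"
    and delta: "0 < \<delta>" "\<delta> < 1"
    and Mhat_povm: "\<And>\<theta> D. povm (Mhat \<theta> D)"
    and Mhat_min: "\<And>\<theta> D M. povm M \<Longrightarrow> emp_risk N rho \<theta> (Mhat \<theta> D) D \<le> emp_risk N rho \<theta> M D"
    and thetahat_min: "\<And>D \<theta>. emp_risk N rho (thetahat D) (Mhat (thetahat D) D) D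
                                \<le> emp_risk N rho \<theta> (Mhat \<theta> D) D"
  shows "measure_pmf.prob (sample_pmf N p)
           {D. exp_risk p rho (thetahat D) (Mhat (thetahat D) D) - opt_risk p rho (thetahat D)
               \<le> 2 * (rad_TM N p rho + rad_M N p rho) / sqrt (real N)
                 + sqrt (2 / real N * ln (2 / \<delta>))} \<ge> 1 - \<delta>
         \<and> rad_M N p rho \<le> 1/2 * sqrt (SUP \<theta>. 2 powr renyi2_MI p rho \<theta>)"
proof
  \<comment> \<open>One bound for all parameters: it gives the second claim and also the boundedness
    of the supremum defining \<open>rad_M\<close>.\<close>
  note le_renyi = rad_class_le_renyi[where rho = rho, OF dens N_pos]
  show "rad_M N p rho \<le> 1/2 * sqrt (SUP \<theta>. 2 powr renyi2_MI p rho \<theta>)"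
    unfolding rad_M_eq by (intro cSUP_least le_renyi) simp
  let ?I = "(UNIV :: 't set) \<times> {M :: bool \<Rightarrow> complex^'n^'n. povm M}"
  let ?S = "sample_pmf N p"
  define g where "g i = loss rho (fst i) (snd i)" for i :: "'t \<times> (bool \<Rightarrow> complex^'n^'n)"
  have I: "?I \<noteq> {}" using povm_exists by auto
  have g0: "0 \<le> g i z" and g1: "g i z \<le> 1" if "i \<in> ?I" for i z
    using that loss_bounds[where rho = rho, OF dens, of "snd i" "fst i" z] by (simp_all add: g_def mem_Times_iff)
  have gabs: "\<bar>g i z\<bar> \<le> 1" if "i \<in> ?I" for i z
    using g0[OF that, of z] g1[OF that, of z] by simp
  have fp: "finite (set_pmf p)" by simp
  have fS: "finite (set_pmf ?S)" using fp by (rule finite_set_sample_pmf)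
  have intS: "integrable ?S h" for h :: "_ \<Rightarrow> real"
    using fS by (rule integrable_measure_pmf_finite)
  have risk: "exp_risk p rho \<theta> M = measure_pmf.expectation p (g (\<theta>, M))"
    and emp: "emp_risk N rho \<theta> M D = (\<Sum>j<N. g (\<theta>, M) (D j)) / real N" for \<theta> M D
    by (simp_all add: exp_risk_def emp_risk_def g_def)
  define G where "G D = (SUP i\<in>?I. measure_pmf.expectation p (g i) - (\<Sum>j<N. g i (D j)) / real N)" for D
  define H where "H D = emp_risk N rho (thetahat D) (Mhat (thetahat D) D) D" for D
  define F where "F D = G D + H D" for D
  define t where "t = sqrt (2 / real N * ln (2 / \<delta>))"
  have ihat: "(thetahat D, Mhat (thetahat D) D) \<in> ?I" for D using Mhat_povm by simp
  have H_le: "H D \<le> (\<Sum>j<N. g i (D j)) / real N" if iI: "i \<in> ?I" for D i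
  proof -
    obtain \<theta> M where i: "i = (\<theta>, M)" "povm M" using iI by auto
    have "H D \<le> emp_risk N rho \<theta> M D"
      unfolding H_def using thetahat_min[of D \<theta>] Mhat_min[OF i(2), of \<theta> D] by (rule order_trans)
    then show ?thesis by (simp add: emp i)
  qed
  have bddG: "bdd_above ((\<lambda>i. measure_pmf.expectation p (g i) - (\<Sum>j<N. g i (D j)) / real N) ` ?I)" for D
  proof (rule bdd_aboveI2)
    fix i assume i: "i \<in> ?I"
    have "measure_pmf.expectation p (g i) \<le> measure_pmf.expectation p (\<lambda>_. 1)"
      using g1[OF i] by (intro expectation_mono_finite) auto
    moreover have "0 \<le> (\<Sum>j<N. g i (D j)) / real N"
      using g0[OF i] by (intro divide_nonneg_nonneg sum_nonneg) auto
    ultimately show "measure_pmf.expectation p (g i) - (\<Sum>j<N. g i (D j)) / real N \<le> 1" by simp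
  qed
  have risk_le: "exp_risk p rho (thetahat D) (Mhat (thetahat D) D) \<le> F D" for D
    using cSUP_upper[OF ihat[of D] bddG[of D]] by (simp add: F_def G_def H_def risk emp)
  \<comment> \<open>For a fixed pair the empirical risk has the expected risk as its mean, and
    \<open>H\<close> lies below it on every data set. The bound holds for all parameters at once, so
    it may later be used at the data-dependent \<open>thetahat D\<close>.\<close>
  have EH: "measure_pmf.expectation ?S H \<le> opt_risk p rho \<theta>" for \<theta>
    unfolding opt_risk_def
  proof (rule cINF_greatest[OF povm_exists])
    fix M :: "bool \<Rightarrow> complex^'n^'n" assume "M \<in> {M. povm M}"
    then have "measure_pmf.expectation ?S H \<le> measure_pmf.expectation ?S (\<lambda>D. (\<Sum>j<N. g (\<theta>, M) (D j)) / real N)"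
      by (intro expectation_mono_finite fS H_le) simp
    also have "\<dots> = exp_risk p rho \<theta> M"
      using N_pos by (simp add: risk expectation_sample_sum[OF fp] del: Bochner_Integration.integral_sum)
    finally show "measure_pmf.expectation ?S H \<le> exp_risk p rho \<theta> M" .
  qed
  have EG: "measure_pmf.expectation ?S G \<le> 2 * rad_TM N p rho / sqrt (real N)"
    unfolding G_def rad_TM_eq using symmetrization[OF fp N_pos I gabs] by (simp add: g_def)
  have radM: "0 \<le> rad_M N p rho"
  proof -
    have "bdd_above (range (\<lambda>\<theta>. rad_class N p {M. povm M} (loss rho \<theta>)))"
      using le_renyi by (intro bdd_aboveI2)
    moreover have "0 \<le> rad_class N p {M. povm M} (loss rho (undefined :: 't))"
      by (intro rad_class_nonneg[OF fp povm_exists]) (use gabs[of "(undefined, _)"] in \<open>simp add: g_def\<close>)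
    ultimately show ?thesis unfolding rad_M_eq by (intro cSUP_upper2) auto
  qed
  have bd: "\<bar>F (D(j := a)) - F D\<bar> \<le> 2 / real N" if j: "j < N" for D j a
  proof (rule bounded_differences_one_sided)
    fix D a
    have "G (D(j := a)) \<le> G D + 1 / real N"
      unfolding G_def
    proof (rule cSUP_least[OF I])
      fix i assume i: "i \<in> ?I"
      show "measure_pmf.expectation p (g i) - (\<Sum>k<N. g i ((D(j := a)) k)) / real N
        \<le> (SUP i\<in>?I. measure_pmf.expectation p (g i) - (\<Sum>k<N. g i (D k)) / real N) + 1 / real N"
        using cSUP_upper[OF i bddG[of D]] average_update_le(2)[where h = "g i" and D = D and a = a, OF g0[OF i] g1[OF i] j] by linarith
    qed
    \<comment> \<open>The minimizer for \<open>D\<close> is a competitor on the updated data set,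
      where its average loss grows by at most \<open>1 / real N\<close>.\<close>
    moreover have "H (D(j := a)) \<le> H D + 1 / real N"
      using H_le[OF ihat[of D], of "D(j := a)"] average_update_le(1)[where h = "g (thetahat D, Mhat (thetahat D) D)" and D = D and a = a, OF g0[OF ihat] g1[OF ihat] j]
      by (simp only: H_def[of D] emp)
    ultimately show "F (D(j := a)) \<le> F D + 2 / real N" by (simp add: F_def)
  qed
  have ln_pos: "ln (2 / \<delta>) > 0" using delta by simp
  have t_pos: "t > 0" using ln_pos N_pos by (simp add: t_def)
  \<comment> \<open>\<open>G\<close> and \<open>H\<close> each change by at most
    \<open>1 / real N\<close>, so the difference constant is \<open>2 / real N\<close>. With this
    \<open>t\<close> the exponent is minus the logarithm of \<open>2 / \<delta>\<close>, and the
    failure probability is at most \<open>\<delta> / 2\<close>.\<close>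
  have "- 2 * t\<^sup>2 / (real N * (2 / real N)\<^sup>2) = - ln (2 / \<delta>)"
    using N_pos ln_pos by (simp add: t_def power2_eq_square field_simps)
  then have "exp (- 2 * t\<^sup>2 / (real N * (2 / real N)\<^sup>2)) = \<delta> / 2"
    using delta by (simp add: exp_minus)
  then have tail: "measure_pmf.prob ?S {D. F D > measure_pmf.expectation ?S F + t} \<le> \<delta> / 2"
    using McDiarmid_inequality[OF fp N_pos _ t_pos bd] N_pos by simp
  have EF: "measure_pmf.expectation ?S F = measure_pmf.expectation ?S G + measure_pmf.expectation ?S H"
    unfolding F_def using intS by simp
  have good: "exp_risk p rho (thetahat D) (Mhat (thetahat D) D) - opt_risk p rho (thetahat D)
      \<le> 2 * (rad_TM N p rho + rad_M N p rho) / sqrt (real N) + t"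
    if "F D \<le> measure_pmf.expectation ?S F + t" for D
  proof -
    have "exp_risk p rho (thetahat D) (Mhat (thetahat D) D) - opt_risk p rho (thetahat D)
      \<le> 2 * rad_TM N p rho / sqrt (real N) + t"
      using risk_le[of D] EH[of "thetahat D"] EG EF that by linarith
    also have "\<dots> \<le> 2 * (rad_TM N p rho + rad_M N p rho) / sqrt (real N) + t"
      using radM by (simp add: divide_right_mono)
    finally show ?thesis .
  qed
  have "1 - \<delta> \<le> 1 - measure_pmf.prob ?S {D. F D > measure_pmf.expectation ?S F + t}"
    using tail delta by linarith
  also have "\<dots> = measure_pmf.prob ?S (UNIV - {D. F D > measure_pmf.expectation ?S F + t})"
    using measure_pmf.prob_compl[of "{D. F D > measure_pmf.expectation ?S F + t}" ?S] by simp
  also have "\<dots> \<le> measure_pmf.prob ?S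
           {D. exp_risk p rho (thetahat D) (Mhat (thetahat D) D) - opt_risk p rho (thetahat D)
               \<le> 2 * (rad_TM N p rho + rad_M N p rho) / sqrt (real N) + t}"
    using good by (intro measure_pmf.finite_measure_mono) (auto simp: not_less)
  finally show "measure_pmf.prob ?S
           {D. exp_risk p rho (thetahat D) (Mhat (thetahat D) D) - opt_risk p rho (thetahat D)
               \<le> 2 * (rad_TM N p rho + rad_M N p rho) / sqrt (real N)
                 + sqrt (2 / real N * ln (2 / \<delta>))} \<ge> 1 - \<delta>"
    unfolding t_def .
qed

end
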